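(* Let $0<|q|<1$, let $A,B,C,D$ be nonzero complex numbers, and let $$a_n=\Big(\tfrac1A+\tfrac1B+\tfrac1C+\tfrac1D\Big)q^n-(1+q)q^{2n-1},\qquad b_n^2=\frac{q}{ABCD}(1-Aq^{n-1})(1-Bq^{n-1})(1-Cq^{n-1})(1-Dq^{n-1}),$$ with $b_n^2\ne0$ for $n>0$. Put $\alpha=\frac12\sqrt{ABCD/q}$, let $x=\alpha z\in\mathbb{C}\setminus[-1,1]$, and let $\lambda_\pm=\frac1{2\alpha}(x\pm\sqrt{x^2-1})$ with the branch chosen so that $|\lambda_-/\lambda_+|<1$. Then, whenever the right-hand side is defined, $$\cfrac{1}{z-a_0-\cfrac{b_1^2}{z-a_1-\cfrac{b_2^2}{z-a_2-\cdots}}}=\frac{ABCD\,\lambda_-}{q\left(1-\frac{BCD\lambda_-}{q}\right)\left(1-\frac{ABC\lambda_-}{q}\right)}\;\frac{{}_3\phi_2\left(\begin{matrix}BC\lambda_-,\,B,\,C\\ BCD\lambda_-,\,ABC\lambda_-\end{matrix};AD\lambda_-\right)}{{}_3\phi_2\left(\begin{matrix}BC\lambda_-,\,B/q,\,C/q\\ BCD\lambda_-/q,\,ABC\lambda_-/q\end{matrix};AD\lambda_-\right)}.$$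
   Context: Notation: $(a)_k=\prod_{j=0}^{k-1}(1-aq^j)$, $(a_1,\dots,a_m)_k=\prod_i(a_i)_k$, ${}_3\phi_2\left(\begin{matrix}a,b,c\\ d,e\end{matrix};w\right)=\sum_{k\ge0}\frac{(a,b,c)_k}{(d,e,q)_k}w^k$ for $|w|<1$, and by analytic (meromorphic) continuation in $w$ for $|w|\ge1$. "Defined" means that no lower parameter is of the form $q^{-k}$ ($k\ge0$), the argument is not a pole of the continuation, and the denominators do not vanish. The value of the infinite continued fraction is the limit of its approximants. *)

theory Defs
  imports "HOL-Complex_Analysis.Complex_Analysis"
begin

definition qpoch :: "complex \<Rightarrow> complex \<Rightarrow> nat \<Rightarrow> complex" where
  "qpoch q a k = (\<Prod>j<k. 1 - a * q ^ j)"

definition phi32_coeff ::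
    "complex \<Rightarrow> complex \<Rightarrow> complex \<Rightarrow> complex \<Rightarrow> complex \<Rightarrow> complex \<Rightarrow> nat \<Rightarrow> complex" where
  "phi32_coeff q a b c d e k =
     (qpoch q a k * qpoch q b k * qpoch q c k) / (qpoch q d k * qpoch q e k * qpoch q q k)"

text \<open>
  The basic hypergeometric function with upper parameters a, b, c and lower parameters d, e,
  as a function of its argument on the whole plane: the meromorphic function that is given
  by the series on the open unit disc.  Being nicely meromorphic means that removable
  singularities are filled in (and that the value at a pole is 0), so the function is unique.
\<close>

definition phi32 ::
    "complex \<Rightarrow> complex \<Rightarrow> complex \<Rightarrow> complex \<Rightarrow> complex \<Rightarrow> complex \<Rightarrow> complex \<Rightarrow> complex" where
  "phi32 q a b c d e =
     (THE f. f nicely_meromorphic_on UNIV \<and>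
             (\<forall>w. norm w < 1 \<longrightarrow> f w = (\<Sum>k. phi32_coeff q a b c d e k * w ^ k)))"

definition phi32_defined ::
    "complex \<Rightarrow> complex \<Rightarrow> complex \<Rightarrow> complex \<Rightarrow> complex \<Rightarrow> complex \<Rightarrow> complex \<Rightarrow> bool" where
  "phi32_defined q a b c d e w \<longleftrightarrow>
     (\<forall>k::nat. d \<noteq> 1 / q ^ k \<and> e \<noteq> 1 / q ^ k) \<and> \<not> is_pole (phi32 q a b c d e) w"

text \<open>
  Numerators and denominators of the approximants of the continued fraction
  u 0 / (v 0 + u 1 / (v 1 + u 2 / (v 2 + ...))).  The n-th approximant keeps the first n
  partial quotients.
\<close>

fun cf_num :: "(nat \<Rightarrow> complex) \<Rightarrow> (nat \<Rightarrow> complex) \<Rightarrow> nat \<Rightarrow> complex" where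
  "cf_num u v 0 = 0"
| "cf_num u v (Suc 0) = u 0"
| "cf_num u v (Suc (Suc n)) = v (Suc n) * cf_num u v (Suc n) + u (Suc n) * cf_num u v n"

fun cf_den :: "(nat \<Rightarrow> complex) \<Rightarrow> (nat \<Rightarrow> complex) \<Rightarrow> nat \<Rightarrow> complex" where
  "cf_den u v 0 = 1"
| "cf_den u v (Suc 0) = v 0"
| "cf_den u v (Suc (Suc n)) = v (Suc n) * cf_den u v (Suc n) + u (Suc n) * cf_den u v n"

text \<open>
  An approximant with vanishing denominator is infinite; as usual, convergence to a finite
  value requires that this happens only finitely often.
\<close>

definition cf_has_value :: "(nat \<Rightarrow> complex) \<Rightarrow> (nat \<Rightarrow> complex) \<Rightarrow> complex \<Rightarrow> bool" where
  "cf_has_value u v L \<longleftrightarrow>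
     (\<forall>\<^sub>F n in sequentially. cf_den u v n \<noteq> 0) \<and>
     (\<lambda>n. cf_num u v n / cf_den u v n) \<longlonglongrightarrow> L"

text \<open>
  The approximants agree with the literally nested finite fractions whenever the latter can
  be evaluated without dividing by zero.
\<close>

fun cf_nested :: "(nat \<Rightarrow> complex) \<Rightarrow> (nat \<Rightarrow> complex) \<Rightarrow> nat \<Rightarrow> complex" where
  "cf_nested u v 0 = 0"
| "cf_nested u v (Suc n) = u 0 / (v 0 + cf_nested (u \<circ> Suc) (v \<circ> Suc) n)"

fun cf_evaluable :: "(nat \<Rightarrow> complex) \<Rightarrow> (nat \<Rightarrow> complex) \<Rightarrow> nat \<Rightarrow> bool" where
  "cf_evaluable u v 0 \<longleftrightarrow> True"
| "cf_evaluable u v (Suc n) \<longleftrightarrow>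
     cf_evaluable (u \<circ> Suc) (v \<circ> Suc) n \<and> v 0 + cf_nested (u \<circ> Suc) (v \<circ> Suc) n \<noteq> 0"

lemma cf_shift:
  "cf_num u v (Suc n) = u 0 * cf_den (u \<circ> Suc) (v \<circ> Suc) n \<and>
   cf_den u v (Suc n) = v 0 * cf_den (u \<circ> Suc) (v \<circ> Suc) n + cf_num (u \<circ> Suc) (v \<circ> Suc) n"
  by (induction n rule: induct_nat_012) (auto simp: algebra_simps)

lemma cf_nested_eq:
  "cf_evaluable u v n \<Longrightarrow>
     cf_den u v n \<noteq> 0 \<and> cf_nested u v n = cf_num u v n / cf_den u v n"
proof (induction n arbitrary: u v)
  case 0
  then show ?case by simp
next
  case (Suc n)
  let ?N = "cf_num (u \<circ> Suc) (v \<circ> Suc) n" and ?D = "cf_den (u \<circ> Suc) (v \<circ> Suc) n"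
  have D: "?D \<noteq> 0" and N: "cf_nested (u \<circ> Suc) (v \<circ> Suc) n = ?N / ?D"
    using Suc.IH[of "u \<circ> Suc" "v \<circ> Suc"] Suc.prems unfolding cf_evaluable.simps by blast+
  have eq: "v 0 + ?N / ?D = (v 0 * ?D + ?N) / ?D"
    using D by (simp add: field_simps)
  have nz: "v 0 + ?N / ?D \<noteq> 0"
    using Suc.prems N by simp
  with eq have "v 0 * ?D + ?N \<noteq> 0" by auto
  moreover have "cf_nested u v (Suc n) = u 0 * ?D / (v 0 * ?D + ?N)"
    by (simp only: cf_nested.simps N eq divide_divide_eq_right)
  ultimately show ?case
    using cf_shift[of u v n] by simp
qed

end

theory Submission
  imports Defs
begin

text \<open>
  Multiplying the series by the infinite product of the factors 1 - w * q ^ j gives an entire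
  function of the argument w, obtained from the unit disc by iterating a q-difference
  equation. For the parameters a, b q^n, c q^n, d q^n, e q^n these entire functions satisfy, at
  w = de/(abc), the recurrence of the continued fraction: a telescoping identity of the
  coefficients for general w shows that the defect is w - de/(abc) times an entire function. Since the
  regularised functions converge to a nonzero limit as n tends to infinity, one obtains a
  solution that behaves like a multiple of lam_m ^ n, i.e. a minimal solution, and the Casoratian
  yields the value of the continued fraction (Pincherle). If the argument were a zero
  of the product, then two consecutive members of the minimal solution would vanish, hence
  all of them, contradicting the nonzero limit; so both regularised values can be divided
  by the product.
\<close>

section \<open>Continued fractions with a minimal solution\<close>

text \<open>The argument A*D*lam_m may have modulus at least 1, where the series cannot be
  manipulated, so identities are proved for |w| < 1 and continued as identities of entire functions.
  The recurrence holds only at w = de/(abc), which leaves no freedom in w for a continuation;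
  keeping the defect for general w restores it. For a = B*C*lam_m, b = B*q^(n-1), c = C*q^(n-1), d =
  B*C*D*lam_m*q^(n-1), e = A*B*C*lam_m*q^(n-1) the quotient de/(abc) is A*D*lam_m for every n. Hence
  one point w and one factor \<open>qpoch_inf q w\<close> serve the whole sequence, in which n = 0
  is the denominator and n = 1 the numerator of the claim. The limit is nonzero because it is a
  regularised 1phi0: it obeys the same first-order equation as the product of the factors 1 -
  a*w*q^j, and a*w = q*lam_m/lam_p has modulus below 1. The branch condition acts a second time as
  |lam_p/lam_m| > 1, which makes the denominators dominate the minimal solution.\<close>

lemma summable_of_ratio_tendsto:
  fixes f :: "nat \<Rightarrow> complex"
  assumes rec: "\<And>n. f (Suc n) = \<rho> n * f n" and lim: "\<rho> \<longlonglongrightarrow> l" and l: "norm l < 1"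
  shows "summable f"
proof -
  obtain m where m: "norm l < m" "m < 1" using l dense by blast
  have "(\<lambda>n. norm (\<rho> n)) \<longlonglongrightarrow> norm l" by (intro tendsto_norm lim)
  then have "eventually (\<lambda>n. norm (\<rho> n) < m) sequentially" by (rule order_tendstoD) (use m in simp)
  then obtain N where N: "\<And>n. n \<ge> N \<Longrightarrow> norm (\<rho> n) < m" unfolding eventually_sequentially by blast
  show ?thesis
  proof (rule summable_ratio_test[where c = m and N = N])
    show "norm (f (Suc n)) \<le> m * norm (f n)" if "n \<ge> N" for n
      unfolding rec norm_mult using N[OF that] by (intro mult_right_mono) auto
  qed (use m in simp)
qed

lemma contracting_tendsto_zero:
  fixes \<delta> \<epsilon> :: "nat \<Rightarrow> complex"
  assumes rec: "\<And>n. \<delta> (Suc n) = \<rho> * (\<delta> n + \<epsilon> n)" and \<rho>: "norm \<rho> < 1" and \<epsilon>: "\<epsilon> \<longlonglongrightarrow> 0"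
  shows "\<delta> \<longlonglongrightarrow> 0"
proof (rule LIMSEQ_I)
  fix e :: real assume e: "e > 0"
  \<comment> \<open>The choice gives \<open>norm \<rho> * (e / 2) + s = e / 2\<close>, so a bound
    with additive term e/2 reproduces itself in the induction.\<close>
  define s where "s = e * (1 - norm \<rho>) / 2"
  have s: "s > 0" using e \<rho> by (simp add: s_def)
  obtain N where N: "\<And>n. n \<ge> N \<Longrightarrow> norm (\<epsilon> n) < s" using LIMSEQ_D[OF \<epsilon> s] by auto
  have b: "norm (\<delta> (N + m)) \<le> norm \<rho> ^ m * norm (\<delta> N) + e / 2" for m
  proof (induction m)
    case 0
    then show ?case using e by simp
  next
    case (Suc m)
    have "norm (\<delta> (N + Suc m)) \<le> norm \<rho> * (norm (\<delta> (N + m)) + norm (\<epsilon> (N + m)))"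
      by (simp add: rec norm_mult norm_triangle_ineq mult_left_mono)
    also have "\<dots> \<le> norm \<rho> * (norm \<rho> ^ m * norm (\<delta> N) + e / 2 + norm (\<epsilon> (N + m)))"
      using Suc by (intro mult_left_mono) auto
    also have "\<dots> = norm \<rho> ^ Suc m * norm (\<delta> N) + norm \<rho> * (e / 2) + norm \<rho> * norm (\<epsilon> (N + m))"
      by (simp add: algebra_simps)
    also have "norm \<rho> * norm (\<epsilon> (N + m)) \<le> 1 * s"
      using N[of "N + m"] \<rho> s by (intro mult_mono) auto
    also have "norm \<rho> ^ Suc m * norm (\<delta> N) + norm \<rho> * (e / 2) + 1 * s
        = norm \<rho> ^ Suc m * norm (\<delta> N) + e / 2"
      by (simp add: s_def field_simps)
    finally show ?case by simp
  qed
  have "(\<lambda>m. norm \<rho> ^ m * norm (\<delta> N)) \<longlonglongrightarrow> 0 * norm (\<delta> N)"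
    by (intro tendsto_intros LIMSEQ_power_zero) (use \<rho> in simp)
  from order_tendstoD(2)[OF this, of "e / 2"] e
  obtain M where M: "\<And>m. m \<ge> M \<Longrightarrow> norm \<rho> ^ m * norm (\<delta> N) < e / 2"
    unfolding eventually_sequentially by auto
  have "norm (\<delta> n - 0) < e" if "n \<ge> N + M" for n
  proof -
    from that have n: "n = N + (n - N)" "n - N \<ge> M" by auto
    then show ?thesis using b[of "n - N"] M[OF n(2)] by simp
  qed
  then show "\<exists>no. \<forall>n\<ge>no. norm (\<delta> n - 0) < e" by blast
qed

text \<open>A Stolz-type limit: K / (r - 1) is the fixed point of y = (y + K) / r, so the deviation
  of \<open>S n / r ^ n\<close> from it obeys a contraction with factor 1/r and a perturbation that
  tends to 0.\<close>

lemma tendsto_ratio_of_geometric_increments: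
  fixes S t :: "nat \<Rightarrow> complex"
  assumes rec: "\<And>n. S (Suc n) = S n + t n" and lim: "(\<lambda>n. t n / r ^ n) \<longlonglongrightarrow> K" and r: "norm r > 1"
  shows "(\<lambda>n. S n / r ^ n) \<longlonglongrightarrow> K / (r - 1)"
proof -
  have r1: "r \<noteq> 0" "r \<noteq> 1" using r by auto
  have "(\<lambda>n. S n / r ^ n - K / (r - 1)) \<longlonglongrightarrow> 0"
  proof (rule contracting_tendsto_zero[where \<rho> = "1 / r" and \<epsilon> = "\<lambda>n. t n / r ^ n - K"])
    fix n
    have "S (Suc n) / r ^ Suc n = 1 / r * (S n / r ^ n + t n / r ^ n)"
      using r1 by (simp add: rec field_simps)
    moreover have "K / (r - 1) = 1 / r * (K / (r - 1) + K)"
      using r1 by (simp add: divide_simps) (simp add: algebra_simps)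
    ultimately show "S (Suc n) / r ^ Suc n - K / (r - 1)
        = 1 / r * (S n / r ^ n - K / (r - 1) + (t n / r ^ n - K))"
      by algebra
  next
    show "norm (1 / r) < 1" using r by (simp add: norm_divide divide_less_eq_1)
    show "(\<lambda>n. t n / r ^ n - K) \<longlonglongrightarrow> 0" using lim by (simp add: LIM_zero)
  qed
  then show ?thesis by (rule LIM_zero_cancel)
qed

text \<open>\<open>W\<close> stands for minus the value of \<open>X\<close> at index -1. The
  denominators solve the same recurrence as \<open>X\<close>, and their Casoratian with
  \<open>X\<close> is a product of partial numerators of order (r * \<mu>^2)^n. So denominator over
  \<open>X\<close> grows like r^n; its reciprocal, divided by \<open>W\<close>, is the error of the
  approximant.\<close>

theorem cf_has_value_of_minimal_solution:
  fixes u v X :: "nat \<Rightarrow> complex" and W \<mu> r U :: complex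
  assumes u0: "u 0 = 1"
    and X_Suc0: "X (Suc 0) = v 0 * X 0 - W"
    and X_rec: "\<And>n. X (Suc (Suc n)) = v (Suc n) * X (Suc n) + u (Suc n) * X n"
    and W: "W \<noteq> 0"
    and X_lim: "(\<lambda>n. X n / \<mu> ^ n) \<longlonglongrightarrow> L" and L: "L \<noteq> 0"
    and u_lim: "(\<lambda>n. (\<Prod>k<n. - u (Suc k)) / (r * \<mu>\<^sup>2) ^ n) \<longlonglongrightarrow> U" and U: "U \<noteq> 0"
    and \<mu>: "\<mu> \<noteq> 0" and r: "norm r > 1"
  shows "cf_has_value u v (X 0 / W)"
proof -
  let ?N = "cf_num u v" and ?D = "cf_den u v"
  have r0: "r \<noteq> 0" "r - 1 \<noteq> 0" using r by auto
  have lin: "X n = X 0 * ?D n - W * ?N n" for n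
    by (induction n rule: induct_nat_012) (simp_all add: u0 X_Suc0 X_rec, simp add: algebra_simps)
  have cas: "?D (Suc n) * X n - ?D n * X (Suc n) = W * (\<Prod>k<n. - u (Suc k))" for n
  proof (induction n)
    case 0
    then show ?case by (simp add: X_Suc0 algebra_simps)
  next
    case (Suc n)
    have "?D (Suc (Suc n)) * X (Suc n) - ?D (Suc n) * X (Suc (Suc n))
        = - u (Suc n) * (?D (Suc n) * X n - ?D n * X (Suc n))"
      by (simp add: X_rec algebra_simps)
    then show ?case unfolding Suc.IH by (simp add: mult_ac)
  qed
  have "eventually (\<lambda>n. X n / \<mu> ^ n \<noteq> 0) sequentially"
    by (rule tendsto_imp_eventually_ne[OF X_lim L])
  then obtain m where m: "\<And>n. n \<ge> m \<Longrightarrow> X n \<noteq> 0"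
    unfolding eventually_sequentially by (metis divide_eq_0_iff)
  \<comment> \<open>The shift by \<open>m\<close> skips the indices at which \<open>X\<close> may
    vanish. The Casoratian makes the increments of \<open>S\<close> explicit; the factor
    \<open>r ^ m\<close> in \<open>K\<close> below compensates the shift.\<close>
  define S where "S n = ?D (n + m) / X (n + m)" for n
  define t where "t n = W * (\<Prod>k<n + m. - u (Suc k)) / (X (n + m) * X (Suc (n + m)))" for n
  have S_rec: "S (Suc n) = S n + t n" for n
    unfolding S_def t_def cas[symmetric] using m[of "n + m"] m[of "Suc (n + m)"]
    by (simp add: field_simps)
  have X_lim1: "(\<lambda>n. X (n + m) / \<mu> ^ (n + m)) \<longlonglongrightarrow> L"
    and X_lim2: "(\<lambda>n. X (Suc (n + m)) / \<mu> ^ Suc (n + m)) \<longlonglongrightarrow> L"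
    using LIMSEQ_ignore_initial_segment[OF X_lim, of m]
      LIMSEQ_ignore_initial_segment[OF X_lim, of "Suc m"] by simp_all
  have u_lim1: "(\<lambda>n. (\<Prod>k<n + m. - u (Suc k)) / (r * \<mu>\<^sup>2) ^ (n + m)) \<longlonglongrightarrow> U"
    by (rule LIMSEQ_ignore_initial_segment[OF u_lim])
  define K where "K = W * r ^ m / \<mu> * (U / (L * L))"
  have "(\<lambda>n. W * r ^ m / \<mu> * ((\<Prod>k<n + m. - u (Suc k)) / (r * \<mu>\<^sup>2) ^ (n + m) /
          (X (n + m) / \<mu> ^ (n + m) * (X (Suc (n + m)) / \<mu> ^ Suc (n + m))))) \<longlonglongrightarrow> K"
    unfolding K_def using L by (intro tendsto_intros u_lim1 X_lim1 X_lim2) auto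
  moreover have "W * r ^ m / \<mu> * ((\<Prod>k<n + m. - u (Suc k)) / (r * \<mu>\<^sup>2) ^ (n + m) /
          (X (n + m) / \<mu> ^ (n + m) * (X (Suc (n + m)) / \<mu> ^ Suc (n + m)))) = t n / r ^ n" for n
  proof -
    have "(r * \<mu>\<^sup>2) ^ (n + m) * \<mu> = r ^ n * r ^ m * (\<mu> ^ (n + m) * \<mu> ^ Suc (n + m))"
      by (simp add: power_mult_distrib power_add power2_eq_square mult_ac)
    then show ?thesis
      unfolding t_def using r0 \<mu> by (simp add: divide_simps)
  qed
  ultimately have t_lim: "(\<lambda>n. t n / r ^ n) \<longlonglongrightarrow> K" by simp
  have "K \<noteq> 0" using W r0 \<mu> U L by (simp add: K_def)
  have S_lim: "(\<lambda>n. S n / r ^ n) \<longlonglongrightarrow> K / (r - 1)"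
    by (rule tendsto_ratio_of_geometric_increments[OF S_rec t_lim r])
  have K': "K / (r - 1) \<noteq> 0" using \<open>K \<noteq> 0\<close> r0 by simp
  have "eventually (\<lambda>n. S n / r ^ n \<noteq> 0) sequentially"
    by (rule tendsto_imp_eventually_ne[OF S_lim K'])
  then have "eventually (\<lambda>n. ?D (n + m) \<noteq> 0) sequentially"
    by (rule eventually_mono) (auto simp: S_def)
  then have D: "eventually (\<lambda>n. ?D n \<noteq> 0) sequentially"
    by (rule eventually_sequentially_seg[THEN iffD1])
  have "(\<lambda>n. (1 / r) ^ n / (S n / r ^ n)) \<longlonglongrightarrow> 0 / (K / (r - 1))"
    using r K' by (intro tendsto_divide[OF LIMSEQ_power_zero S_lim]) (auto simp: norm_divide divide_less_eq_1)
  moreover have "(1 / r) ^ n / (S n / r ^ n) = X (n + m) / ?D (n + m)" for n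
    using r0 by (simp add: S_def power_one_over)
  ultimately have "(\<lambda>n. X (n + m) / ?D (n + m)) \<longlonglongrightarrow> 0" by simp
  then have XD: "(\<lambda>n. X n / ?D n) \<longlonglongrightarrow> 0" by (rule LIMSEQ_offset)
  have "(\<lambda>n. X 0 / W - X n / ?D n / W) \<longlonglongrightarrow> X 0 / W - 0 / W"
    using W by (intro tendsto_intros XD)
  moreover have "eventually (\<lambda>n. X 0 / W - X n / ?D n / W = ?N n / ?D n) sequentially"
    using D
  proof eventually_elim
    case (elim n)
    then show ?case using W by (subst (2) lin) (simp add: field_simps)
  qed
  ultimately have "(\<lambda>n. ?N n / ?D n) \<longlonglongrightarrow> X 0 / W"
    by (simp add: tendsto_cong)
  with D show ?thesis unfolding cf_has_value_def by blast
qed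

section \<open>Linear q-difference equations\<close>

lemma tendsto_geometric_zero:
  fixes q a :: complex
  assumes "norm q < 1"
  shows "(\<lambda>n. a * q ^ n) \<longlonglongrightarrow> 0"
  using tendsto_mult_left[OF LIMSEQ_power_zero[OF assms], of a] by simp

lemma qpow_Suc_neq_1:
  fixes q :: complex
  assumes "norm q < 1"
  shows "q * q ^ k \<noteq> 1"
proof
  assume "q * q ^ k = 1"
  then have "norm q ^ Suc k = 1" by (metis norm_one norm_power power_Suc)
  moreover have "norm q * norm q ^ k \<le> norm q * 1"
    using assms by (intro mult_left_mono power_le_one) auto
  ultimately show False using assms by simp
qed

text \<open>The right-hand side at w sees only the points q*w, q^2*w, q^3*w, so applied to a
  function given for |q^n*w| < 1 it yields one for |q^(n+1)*w| < 1. The iterates agree where they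
  overlap, and their domains exhaust the plane.\<close>

lemma entire_extension_by_q_difference_equation:
  fixes q :: complex and g p1 p2 p3 :: "complex \<Rightarrow> complex"
  assumes q: "norm q < 1" and g: "g holomorphic_on ball 0 1"
    and p: "p1 holomorphic_on UNIV" "p2 holomorphic_on UNIV" "p3 holomorphic_on UNIV"
    and eq: "\<And>w. norm w < 1 \<Longrightarrow> g w = p1 w * g (q * w) + p2 w * g (q\<^sup>2 * w) + p3 w * g (q ^ 3 * w)"
  obtains G where "G holomorphic_on UNIV" "\<And>w. norm w < 1 \<Longrightarrow> G w = g w"
    "\<And>w. G w = p1 w * G (q * w) + p2 w * G (q\<^sup>2 * w) + p3 w * G (q ^ 3 * w)"
proof -
  define T where "T h w = p1 w * h (q * w) + p2 w * h (q\<^sup>2 * w) + p3 w * h (q ^ 3 * w)"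
    for h and w :: complex
  define h where "h n = (T ^^ n) g" for n
  have h0: "h 0 = g" and hS: "h (Suc n) w = T (h n) w" for n w by (simp_all add: h_def)
  define V where "V n = {w. norm (q ^ n * w) < 1}" for n
  have V_open: "open (V n)" for n
    unfolding V_def by (intro open_Collect_less continuous_intros)
  have shrink: "norm (q ^ i * w) \<le> norm w" for i w
    using q by (simp add: norm_mult norm_power mult_left_le_one_le power_le_one)
  have V_Suc: "q * w \<in> V n" "q\<^sup>2 * w \<in> V n" "q ^ 3 * w \<in> V n" if "w \<in> V (Suc n)" for w n
  proof -
    have *: "norm (q ^ n * (q ^ Suc i * w)) < 1" for i
    proof -
      have "q ^ n * (q ^ Suc i * w) = q ^ i * (q ^ Suc n * w)" by (simp add: mult_ac)
      then show ?thesis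
        using order.strict_trans1[OF shrink[of i "q ^ Suc n * w"]] that by (simp only: V_def mem_Collect_eq)
    qed
    show "q * w \<in> V n" "q\<^sup>2 * w \<in> V n" "q ^ 3 * w \<in> V n"
      using *[of 0] *[of 1] *[of 2] by (simp_all add: V_def power2_eq_square power3_eq_cube mult_ac)
  qed
  have V_mono: "w \<in> V (n + m)" if "w \<in> V n" for w n m
    using shrink[of m "q ^ n * w"] that by (simp add: V_def power_add mult_ac)
  have step: "h (Suc n) w = h n w" if "w \<in> V n" for n w
    using that
  proof (induction n arbitrary: w)
    case 0
    then show ?case using eq[of w] by (simp add: hS h0 T_def V_def)
  next
    case (Suc n)
    show ?case
      by (subst (1 2) hS) (simp add: T_def Suc.IH V_Suc[OF Suc.prems])
  qed
  have stable: "h (n + m) w = h n w" if "w \<in> V n" for n m w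
    by (induction m) (use step V_mono that in auto)
  have h_holo: "h n holomorphic_on V n" for n
  proof (induction n)
    case 0
    have "V 0 = ball 0 1" by (auto simp: V_def)
    then show ?case using g by (simp add: h0)
  next
    case (Suc n)
    have comp: "(\<lambda>w. h n (q * w)) holomorphic_on V (Suc n)"
      "(\<lambda>w. h n (q\<^sup>2 * w)) holomorphic_on V (Suc n)"
      "(\<lambda>w. h n (q ^ 3 * w)) holomorphic_on V (Suc n)"
      by (rule holomorphic_on_compose_gen[OF _ Suc, unfolded o_def];
          use V_Suc in \<open>auto intro!: holomorphic_intros\<close>)+
    have "(\<lambda>w. T (h n) w) holomorphic_on V (Suc n)"
      unfolding T_def
      by (intro holomorphic_intros comp holomorphic_on_subset[OF p(1)]
          holomorphic_on_subset[OF p(2)] holomorphic_on_subset[OF p(3)]) auto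
    then show ?case by (subst hS[abs_def]) simp
  qed
  have cover: "\<exists>n. w \<in> V n" for w
  proof -
    have "(\<lambda>n. norm (w * q ^ n)) \<longlonglongrightarrow> 0"
      using tendsto_norm[OF tendsto_geometric_zero[OF q, of w]] by simp
    from order_tendstoD(2)[OF this, of 1] show ?thesis
      by (auto simp: V_def eventually_sequentially mult_ac)
  qed
  define G where "G w = h (LEAST n. w \<in> V n) w" for w
  have G_eq: "G w = h n w" if "w \<in> V n" for w n
  proof -
    have "w \<in> V (LEAST n. w \<in> V n)" by (rule LeastI) (rule that)
    moreover have "(LEAST n. w \<in> V n) \<le> n" by (rule Least_le) (rule that)
    ultimately show ?thesis
      unfolding G_def using stable by (metis le_add_diff_inverse)
  qed
  have "G holomorphic_on V n" for n
    using h_holo[of n] by (rule holomorphic_transform) (simp add: G_eq)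
  then have "G holomorphic_on (\<Union>n\<in>UNIV. V n)"
    by (intro holomorphic_on_UN_open V_open) auto
  moreover have "(\<Union>n\<in>UNIV. V n) = UNIV" using cover by auto
  ultimately have "G holomorphic_on UNIV" by simp
  moreover have "G w = g w" if "norm w < 1" for w
    using G_eq[of w 0] that by (simp add: V_def h0)
  moreover have "G w = p1 w * G (q * w) + p2 w * G (q\<^sup>2 * w) + p3 w * G (q ^ 3 * w)" for w
  proof -
    obtain n where n: "w \<in> V n" using cover by blast
    have n': "w \<in> V (Suc n)" using V_mono[OF n, of 1] by simp
    show ?thesis
      using G_eq[OF n'] by (simp add: hS T_def G_eq[OF V_Suc(1)[OF n']] G_eq[OF V_Suc(2)[OF n']]
          G_eq[OF V_Suc(3)[OF n']])
  qed
  ultimately show ?thesis by (rule that)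
qed

text \<open>A zero at w propagates to all w*q^n, since the linear factors met on the way do not
  vanish; these points tend to 0, and continuity would force \<open>g 0 = 0\<close>.\<close>

lemma nonzero_of_q_difference_equation:
  fixes g :: "complex \<Rightarrow> complex"
  assumes q: "norm q < 1" and cont: "isCont g 0" and g0: "g 0 \<noteq> 0"
    and eq: "\<And>w. g w = (1 - c * w) * g (q * w)"
    and nz: "\<And>j. c * w * q ^ j \<noteq> 1"
  shows "g w \<noteq> 0"
proof
  assume "g w = 0"
  then have z: "g (w * q ^ n) = 0" for n
  proof (induction n)
    case (Suc n)
    have "1 - c * (w * q ^ n) \<noteq> 0" using nz[of n] by (simp add: mult_ac)
    then show ?case using eq[of "w * q ^ n"] Suc by (simp add: mult_ac)
  qed simp
  have "(\<lambda>n. g (w * q ^ n)) \<longlonglongrightarrow> g 0"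
    by (rule isCont_tendsto_compose[OF cont tendsto_geometric_zero[OF q]])
  then have "g 0 = 0" by (simp add: z LIMSEQ_const_iff)
  with g0 show False by simp
qed

text \<open>Euler's expansion of the infinite product of the factors 1 - w * q ^ j.\<close>

definition qpoch_inf :: "complex \<Rightarrow> complex \<Rightarrow> complex" where
  "qpoch_inf q w = (\<Sum>k. (\<Prod>j<k. - (q ^ j) / (1 - q * q ^ j)) * w ^ k)"

context
  fixes q :: complex
  assumes q: "norm q < 1"
begin

lemma qpoch_inf_sums: "(\<lambda>k. (\<Prod>j<k. - (q ^ j) / (1 - q * q ^ j)) * w ^ k) sums qpoch_inf q w"
proof -
  have "(\<lambda>k. - (1 * q ^ k) / (1 - q * q ^ k) * w) \<longlonglongrightarrow> - 0 / (1 - 0) * w"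
    by (intro tendsto_intros tendsto_geometric_zero q) auto
  then have "summable (\<lambda>k. (\<Prod>j<k. - (q ^ j) / (1 - q * q ^ j)) * w ^ k)"
    by (intro summable_of_ratio_tendsto[where \<rho> = "\<lambda>k. - (1 * q ^ k) / (1 - q * q ^ k) * w"]) auto
  then show ?thesis unfolding qpoch_inf_def by (rule summable_sums)
qed

lemma qpoch_inf_holomorphic: "qpoch_inf q holomorphic_on A"
proof -
  have "qpoch_inf q holomorphic_on (\<Union>n\<in>UNIV. ball 0 (real n))"
    by (intro holomorphic_on_UN_open power_series_holomorphic) (use qpoch_inf_sums in auto)
  moreover have "(\<Union>n\<in>UNIV. ball 0 (real n)) = (UNIV :: complex set)"
    using reals_Archimedean2 by auto
  ultimately show ?thesis by (metis holomorphic_on_subset subset_UNIV)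
qed

lemma qpoch_inf_isCont: "isCont (qpoch_inf q) w"
  using holomorphic_on_imp_continuous_on[OF qpoch_inf_holomorphic[of UNIV]]
  by (simp add: continuous_on_eq_continuous_at)

lemma qpoch_inf_0: "qpoch_inf q 0 = 1"
  using sums_unique2[OF qpoch_inf_sums[of 0] powser_sums_zero] by simp

lemma qpoch_inf_eq: "qpoch_inf q w = (1 - w) * qpoch_inf q (q * w)"
proof -
  define e where "e k = (\<Prod>j<k. - (q ^ j) / (1 - q * q ^ j))" for k
  \<comment> \<open>This is the functional equation compared at w^(k+1).\<close>
  have e_Suc: "e (Suc k) * (1 - q * q ^ k) = - (q ^ k) * e k" for k
    using qpow_Suc_neq_1[OF q, of k] by (simp add: e_def)
  have s: "(\<lambda>k. e k * w ^ k) sums qpoch_inf q w" for w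
    unfolding e_def by (rule qpoch_inf_sums)
  have "(\<lambda>k. e k * w ^ k - e k * (q * w) ^ k) sums (qpoch_inf q w - qpoch_inf q (q * w))"
    by (intro sums_diff s)
  moreover have "(\<lambda>k. e k * w ^ k - e k * (q * w) ^ k) sums (- w * qpoch_inf q (q * w) + 0)"
  proof -
    have "(\<lambda>k. e (Suc k) * w ^ Suc k - e (Suc k) * (q * w) ^ Suc k)
        = (\<lambda>k. - w * (e k * (q * w) ^ k))"
    proof
      fix k
      have "e (Suc k) * w ^ Suc k - e (Suc k) * (q * w) ^ Suc k
          = (e (Suc k) * (1 - q * q ^ k)) * w ^ Suc k"
        by (simp add: power_mult_distrib algebra_simps)
      then show "e (Suc k) * w ^ Suc k - e (Suc k) * (q * w) ^ Suc k = - w * (e k * (q * w) ^ k)"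
        by (simp add: e_Suc power_mult_distrib)
    qed
    moreover have "(\<lambda>k. - w * (e k * (q * w) ^ k)) sums (- w * qpoch_inf q (q * w))"
      by (intro sums_mult s)
    ultimately show ?thesis
      using sums_Suc[of "\<lambda>k. e k * w ^ k - e k * (q * w) ^ k"] by simp
  qed
  ultimately have "qpoch_inf q w - qpoch_inf q (q * w) = - w * qpoch_inf q (q * w) + 0"
    by (rule sums_unique2)
  then show ?thesis by (simp add: algebra_simps)
qed

lemma qpoch_inf_nonzero:
  assumes "\<And>j. w * q ^ j \<noteq> 1"
  shows "qpoch_inf q w \<noteq> 0"
proof (rule nonzero_of_q_difference_equation[OF q qpoch_inf_isCont, where c = 1])
  show "qpoch_inf q w = (1 - 1 * w) * qpoch_inf q (q * w)" for w
    unfolding mult_1 by (rule qpoch_inf_eq)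
qed (use assms in \<open>simp_all add: qpoch_inf_0\<close>)

lemma mult_qpow_neq_1:
  assumes "norm (w::complex) < 1"
  shows "w * q ^ j \<noteq> 1"
proof
  assume "w * q ^ j = 1"
  then have "norm w * norm q ^ j = 1" by (metis norm_mult norm_one norm_power)
  moreover have "norm w * norm q ^ j \<le> norm w * 1"
    using q by (intro mult_left_mono power_le_one) auto
  ultimately show False using assms by simp
qed

lemma qpoch_inf_nonzero_disc: "norm w < 1 \<Longrightarrow> qpoch_inf q w \<noteq> 0"
  by (intro qpoch_inf_nonzero mult_qpow_neq_1)

lemma qpoch_inf_split: "qpoch_inf q w = qpoch q w n * qpoch_inf q (w * q ^ n)"
proof (induction n)
  case (Suc n)
  then show ?case using qpoch_inf_eq[of "w * q ^ n"] by (simp add: qpoch_def mult_ac)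
qed (simp add: qpoch_def)

text \<open>Ties Euler's series to the finite products: the tail factor in
  \<open>qpoch_inf_split\<close> tends to 1 by continuity at 0, hence is eventually nonzero and can
  be divided out, even if w is a zero.\<close>

lemma qpoch_tendsto: "qpoch q w \<longlonglongrightarrow> qpoch_inf q w"
proof -
  have lim: "(\<lambda>n. qpoch_inf q (w * q ^ n)) \<longlonglongrightarrow> 1"
    using isCont_tendsto_compose[OF qpoch_inf_isCont tendsto_geometric_zero[OF q]]
    by (simp add: qpoch_inf_0)
  then have "(\<lambda>n. qpoch_inf q w / qpoch_inf q (w * q ^ n)) \<longlonglongrightarrow> qpoch_inf q w / 1"
    by (intro tendsto_intros) auto
  moreover have "eventually (\<lambda>n. qpoch_inf q (w * q ^ n) \<noteq> 0) sequentially"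
    using lim by (rule tendsto_imp_eventually_ne) simp
  then have "eventually (\<lambda>n. qpoch_inf q w / qpoch_inf q (w * q ^ n) = qpoch q w n) sequentially"
    by eventually_elim (metis qpoch_inf_split nonzero_mult_div_cancel_right)
  ultimately show ?thesis by (simp add: tendsto_cong)
qed

end

section \<open>Regularised basic hypergeometric functions\<close>

definition phi32_series ::
    "complex \<Rightarrow> complex \<Rightarrow> complex \<Rightarrow> complex \<Rightarrow> complex \<Rightarrow> complex \<Rightarrow> complex \<Rightarrow> complex" where
  "phi32_series q a b c d e w = (\<Sum>k. phi32_coeff q a b c d e k * w ^ k)"

text \<open>For nonzero q this is the condition on the lower parameters in
  \<open>phi32_defined\<close>; in product form it passes to d*q and e*q by a shift of k.\<close>

definition lower_ok :: "complex \<Rightarrow> complex \<Rightarrow> complex \<Rightarrow> bool" where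
  "lower_ok q d e \<longleftrightarrow> (\<forall>k. d * q ^ k \<noteq> 1 \<and> e * q ^ k \<noteq> 1)"

definition phi32_ratio ::
    "complex \<Rightarrow> complex \<Rightarrow> complex \<Rightarrow> complex \<Rightarrow> complex \<Rightarrow> complex \<Rightarrow> nat \<Rightarrow> complex" where
  "phi32_ratio q a b c d e k =
     (1 - a * q ^ k) * (1 - b * q ^ k) * (1 - c * q ^ k) /
     ((1 - d * q ^ k) * (1 - e * q ^ k) * (1 - q * q ^ k))"

lemma phi32_coeff_0 [simp]: "phi32_coeff q a b c d e 0 = 1"
  by (simp add: phi32_coeff_def qpoch_def)

lemma phi32_coeff_Suc:
  "phi32_coeff q a b c d e (Suc k) = phi32_ratio q a b c d e k * phi32_coeff q a b c d e k"
  by (simp add: phi32_coeff_def phi32_ratio_def qpoch_def mult_ac)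

text \<open>
  All poles of the continued series are simple and lie at zeros of qpoch_inf, so the product with
  qpoch_inf is entire; the last clause is the q-difference equation that the coefficient
  recurrence imposes on this product.
\<close>

definition is_regularization ::
    "complex \<Rightarrow> complex \<Rightarrow> complex \<Rightarrow> complex \<Rightarrow> complex \<Rightarrow> complex \<Rightarrow> (complex \<Rightarrow> complex) \<Rightarrow> bool" where
  "is_regularization q a b c d e G \<longleftrightarrow>
     G holomorphic_on UNIV \<and>
     (\<forall>w. norm w < 1 \<longrightarrow> G w = qpoch_inf q w * phi32_series q a b c d e w) \<and>
     (\<forall>w. G w = ((1 + d/q + e/q) - w * (a + b + c)) * G (q * w)
        + (1 - q * w) * (w * (a*b + a*c + b*c) - (d/q + e/q + d*e/q\<^sup>2)) * G (q\<^sup>2 * w)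
        + (1 - q * w) * (1 - q\<^sup>2 * w) * (d*e/q\<^sup>2 - w * (a*b*c)) * G (q ^ 3 * w))"

definition phi32_reg ::
    "complex \<Rightarrow> complex \<Rightarrow> complex \<Rightarrow> complex \<Rightarrow> complex \<Rightarrow> complex \<Rightarrow> complex \<Rightarrow> complex" where
  "phi32_reg q a b c d e = (SOME G. is_regularization q a b c d e G)"

section \<open>Uniqueness of continuation from the unit disc\<close>

lemma entire_eqI:
  fixes f g :: "complex \<Rightarrow> complex"
  assumes "f holomorphic_on UNIV" "g holomorphic_on UNIV"
    and "\<And>w. norm w < 1 \<Longrightarrow> f w = g w"
  shows "f w = g w"
  by (rule analytic_continuation_open[of "ball 0 1" UNIV f g]) (use assms in auto)

text \<open>Only punctured neighbourhoods can be claimed, because a meromorphic function may take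
  arbitrary values at isolated points. The identity theorem is applied to
  \<open>remove_sings f\<close>, which agrees with f near every point.\<close>

lemma meromorphic_eventually_zero:
  fixes f :: "complex \<Rightarrow> complex"
  assumes mero: "f meromorphic_on UNIV" and zero: "\<And>w. norm w < 1 \<Longrightarrow> f w = 0"
  shows "eventually (\<lambda>w. f w = 0) (at z)"
proof -
  have disc: "remove_sings f w = 0" if "w \<in> ball 0 1" for w
  proof (rule remove_sings_eqI)
    have "eventually (\<lambda>u. u \<in> ball 0 1) (at w)"
      using that by (intro eventually_at_in_open') auto
    then have "eventually (\<lambda>u. f u = 0) (at w)"
      by eventually_elim (use zero in auto)
    then show "f \<midarrow>w\<rightarrow> 0" by (rule tendsto_eventually)
  qed
  have "eventually (\<lambda>w. w \<in> ball 0 1) (at (0::complex))"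
    by (intro eventually_at_in_open') auto
  then have "eventually (\<lambda>w. remove_sings f w = 0) (at 0)"
    by eventually_elim (use disc in auto)
  then have freq: "frequently (\<lambda>w. remove_sings f w = 0) (at 0)"
    by (intro eventually_frequently) auto
  have "remove_sings f w = 0" for w
    by (rule frequently_eq_meromorphic_imp_constant[OF freq remove_sings_nicely_meromorphic[OF mero]]) auto
  moreover have "isolated_singularity_at f z"
    using meromorphic_on_subset[OF mero, of "{z}"] by (simp add: meromorphic_at_iff)
  then have "eventually (\<lambda>w. remove_sings f w = f w) (at z)"
    by (rule eventually_remove_sings_eq_at)
  ultimately show ?thesis by simp
qed

text \<open>The uniqueness behind the \<open>THE\<close> in \<open>phi32\<close>. Agreement near z
  leaves only the value at z itself: at a pole both values are 0 by convention, elsewhere both are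
  limits.\<close>

lemma nicely_meromorphic_eqI:
  fixes f g :: "complex \<Rightarrow> complex"
  assumes f: "f nicely_meromorphic_on UNIV" and g: "g nicely_meromorphic_on UNIV"
    and eq: "\<And>w. norm w < 1 \<Longrightarrow> f w = g w"
  shows "f = g"
proof
  fix z
  have "(\<lambda>w. f w - g w) meromorphic_on UNIV"
    using f g by (intro meromorphic_intros) (auto simp: nicely_meromorphic_on_def)
  from meromorphic_eventually_zero[OF this]
  have ev: "eventually (\<lambda>w. f w = g w) (at z)" using eq by simp
  have pole: "is_pole f z \<longleftrightarrow> is_pole g z" using ev by (intro is_pole_cong) auto
  show "f z = g z"
  proof (cases "is_pole f z")
    case True
    with pole have "is_pole g z" by simp
    have "f z = 0"
      using f True at_neq_bot not_tendsto_and_filterlim_at_infinity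
      unfolding nicely_meromorphic_on_def is_pole_def by blast
    moreover have "g z = 0"
      using g \<open>is_pole g z\<close> at_neq_bot not_tendsto_and_filterlim_at_infinity
      unfolding nicely_meromorphic_on_def is_pole_def by blast
    ultimately show ?thesis by simp
  next
    case False
    then have "f \<midarrow>z\<rightarrow> f z" "g \<midarrow>z\<rightarrow> g z"
      using f g pole unfolding nicely_meromorphic_on_def by auto
    moreover from this(2) have "f \<midarrow>z\<rightarrow> g z" using tendsto_cong[OF ev] by simp
    ultimately show ?thesis using LIM_unique by blast
  qed
qed

context
  fixes q :: complex
  assumes q: "norm q < 1" and q0: "q \<noteq> 0"
begin

lemma phi32_ratio_tendsto: "phi32_ratio q a b c d e \<longlonglongrightarrow> 1"
proof -
  have "(\<lambda>k. (1 - a * q ^ k) * (1 - b * q ^ k) * (1 - c * q ^ k) /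
     ((1 - d * q ^ k) * (1 - e * q ^ k) * (1 - q * q ^ k))) \<longlonglongrightarrow>
     (1 - 0) * (1 - 0) * (1 - 0) / ((1 - 0) * (1 - 0) * (1 - 0))"
    by (intro tendsto_intros tendsto_geometric_zero q) auto
  then show ?thesis by (simp add: phi32_ratio_def[abs_def])
qed

lemma phi32_series_sums:
  assumes "norm w < 1"
  shows "(\<lambda>k. phi32_coeff q a b c d e k * w ^ k) sums phi32_series q a b c d e w"
proof -
  have "(\<lambda>k. phi32_ratio q a b c d e k * w) \<longlonglongrightarrow> 1 * w"
    by (intro tendsto_intros phi32_ratio_tendsto)
  then have "summable (\<lambda>k. phi32_coeff q a b c d e k * w ^ k)"
    by (intro summable_of_ratio_tendsto[where \<rho> = "\<lambda>k. phi32_ratio q a b c d e k * w"])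
      (use assms in \<open>auto simp: phi32_coeff_Suc\<close>)
  then show ?thesis unfolding phi32_series_def by (rule summable_sums)
qed

lemma phi32_series_0: "phi32_series q a b c d e 0 = 1"
  using sums_unique2[OF phi32_series_sums[of 0] powser_sums_zero] by simp

lemma phi32_series_holomorphic: "phi32_series q a b c d e holomorphic_on ball 0 1"
  by (rule power_series_holomorphic) (use phi32_series_sums in auto)

lemma norm_qpow_mult_less: "norm w < 1 \<Longrightarrow> norm (q ^ i * w) < 1"
  using mult_right_mono[of "norm q ^ i" 1 "norm w"] power_le_one[of "norm q" i] q
  by (simp add: norm_mult norm_power)

text \<open>Multiplying the k-th coefficient by \<open>(q ^ k) ^ i\<close> replaces w by q^i*w. This
  translates coefficient identities polynomial in \<open>q ^ k\<close> into q-difference relations: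
  cubic for the equation of the series, quadratic for the certificate.\<close>

lemma phi32_series_poly_sums:
  assumes w: "norm w < 1"
  shows "(\<lambda>k. phi32_coeff q a b c d e k * (p0 + p1 * q ^ k + p2 * (q ^ k)\<^sup>2 + p3 * (q ^ k) ^ 3) * w ^ k)
    sums (p0 * phi32_series q a b c d e w + p1 * phi32_series q a b c d e (q * w)
      + p2 * phi32_series q a b c d e (q\<^sup>2 * w) + p3 * phi32_series q a b c d e (q ^ 3 * w))"
proof -
  let ?c = "phi32_coeff q a b c d e"
  have s: "(\<lambda>k. ?c k * (q ^ i * w) ^ k) sums phi32_series q a b c d e (q ^ i * w)" for i
    by (rule phi32_series_sums) (rule norm_qpow_mult_less[OF w])
  have "(\<lambda>k. p0 * (?c k * (q ^ 0 * w) ^ k) + p1 * (?c k * (q ^ 1 * w) ^ k)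
      + p2 * (?c k * (q ^ 2 * w) ^ k) + p3 * (?c k * (q ^ 3 * w) ^ k))
    sums (p0 * phi32_series q a b c d e (q ^ 0 * w) + p1 * phi32_series q a b c d e (q ^ 1 * w)
      + p2 * phi32_series q a b c d e (q\<^sup>2 * w) + p3 * phi32_series q a b c d e (q ^ 3 * w))"
    by (intro sums_add sums_mult s)
  moreover have "p0 * (?c k * (q ^ 0 * w) ^ k) + p1 * (?c k * (q ^ 1 * w) ^ k)
      + p2 * (?c k * (q ^ 2 * w) ^ k) + p3 * (?c k * (q ^ 3 * w) ^ k)
      = ?c k * (p0 + p1 * q ^ k + p2 * (q ^ k)\<^sup>2 + p3 * (q ^ k) ^ 3) * w ^ k" for k
    by (simp add: power_mult_distrib power2_eq_square power3_eq_cube algebra_simps)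
  ultimately show ?thesis by simp
qed

lemma phi32_series_q_difference:
  fixes a b c d e w :: complex
  assumes ok: "lower_ok q d e" and w: "norm w < 1"
  defines "F \<equiv> phi32_series q a b c d e"
  shows "(1 - w) * F w = ((1 + d/q + e/q) - w * (a + b + c)) * F (q * w)
    + (w * (a*b + a*c + b*c) - (d/q + e/q + d*e/q\<^sup>2)) * F (q\<^sup>2 * w)
    + (d*e/q\<^sup>2 - w * (a*b*c)) * F (q ^ 3 * w)"
proof -
  let ?c = "phi32_coeff q a b c d e"
  have rec: "?c (Suc k) * ((1 - d * q ^ k) * (1 - e * q ^ k) * (1 - q * q ^ k))
      = ?c k * ((1 - a * q ^ k) * (1 - b * q ^ k) * (1 - c * q ^ k))" for k
  proof -
    have "x / y * z * y = z * x" if "y \<noteq> 0" for x y z :: complex using that by simp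
    then show ?thesis
      using ok qpow_Suc_neq_1[OF q, of k] unfolding phi32_coeff_Suc phi32_ratio_def lower_ok_def
      by simp
  qed
  \<comment> \<open>With t = q^k the polynomial in \<open>L\<close> is (1-t)(1-d*t/q)(1-e*t/q), the
    one in \<open>R\<close> is (1-a*t)(1-b*t)(1-c*t). The coefficient recurrence becomes L (k+1) = w
    * R k, and the factor 1-t kills \<open>L 0\<close>.\<close>
  define L where "L k = ?c k * (1 + (- (1 + d/q + e/q)) * q ^ k
      + (d/q + e/q + d*e/q\<^sup>2) * (q ^ k)\<^sup>2 + (- (d*e/q\<^sup>2)) * (q ^ k) ^ 3) * w ^ k" for k
  define R where "R k = ?c k * (1 + (- (a + b + c)) * q ^ k
      + (a*b + a*c + b*c) * (q ^ k)\<^sup>2 + (- (a*b*c)) * (q ^ k) ^ 3) * w ^ k" for k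
  have L: "L sums (1 * F w + (- (1 + d/q + e/q)) * F (q * w)
      + (d/q + e/q + d*e/q\<^sup>2) * F (q\<^sup>2 * w) + (- (d*e/q\<^sup>2)) * F (q ^ 3 * w))"
    unfolding L_def[abs_def] F_def by (rule phi32_series_poly_sums[OF w])
  have R: "R sums (1 * F w + (- (a + b + c)) * F (q * w)
      + (a*b + a*c + b*c) * F (q\<^sup>2 * w) + (- (a*b*c)) * F (q ^ 3 * w))"
    unfolding R_def[abs_def] F_def by (rule phi32_series_poly_sums[OF w])
  have L0: "L 0 = 0" by (simp add: L_def)
  have "L (Suc k) = w * R k" for k
  proof -
    have "1 + (- (1 + d/q + e/q)) * q ^ Suc k + (d/q + e/q + d*e/q\<^sup>2) * (q ^ Suc k)\<^sup>2
        + (- (d*e/q\<^sup>2)) * (q ^ Suc k) ^ 3 = (1 - d * q ^ k) * (1 - e * q ^ k) * (1 - q * q ^ k)"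
      using q0 by (simp add: power2_eq_square power3_eq_cube field_simps)
    moreover have "1 + (- (a + b + c)) * q ^ k + (a*b + a*c + b*c) * (q ^ k)\<^sup>2
        + (- (a*b*c)) * (q ^ k) ^ 3 = (1 - a * q ^ k) * (1 - b * q ^ k) * (1 - c * q ^ k)"
      by (simp add: power2_eq_square power3_eq_cube algebra_simps)
    ultimately show ?thesis unfolding L_def R_def by (simp only: rec) (simp add: mult_ac)
  qed
  then have "(\<lambda>k. L (Suc k)) sums (w * (1 * F w + (- (a + b + c)) * F (q * w)
      + (a*b + a*c + b*c) * F (q\<^sup>2 * w) + (- (a*b*c)) * F (q ^ 3 * w)))"
    using sums_mult[OF R, of w] by simp
  from sums_unique2[OF L sums_Suc[OF this]] show ?thesis
    unfolding L0 by algebra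
qed

text \<open>The factor 1 - w in front of F w blocks continuation of the series by iteration. Since
  qpoch_inf q w = (1 - w) * qpoch_inf q (q*w), multiplication by \<open>qpoch_inf\<close> absorbs it
  and leaves polynomial coefficients.\<close>

lemma is_regularization_phi32_reg:
  assumes ok: "lower_ok q d e"
  shows "is_regularization q a b c d e (phi32_reg q a b c d e)"
proof -
  let ?F = "phi32_series q a b c d e" and ?E = "qpoch_inf q"
  have "\<exists>G. is_regularization q a b c d e G"
  proof (rule entire_extension_by_q_difference_equation[OF q,
      where g = "\<lambda>w. ?E w * ?F w" and
        ?p1.0 = "\<lambda>w. (1 + d/q + e/q) - w * (a + b + c)" and
        ?p2.0 = "\<lambda>w. (1 - q * w) * (w * (a*b + a*c + b*c) - (d/q + e/q + d*e/q\<^sup>2))" and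
        ?p3.0 = "\<lambda>w. (1 - q * w) * (1 - q\<^sup>2 * w) * (d*e/q\<^sup>2 - w * (a*b*c))"])
    fix w :: complex assume w: "norm w < 1"
    have E: "?E w = (1 - w) * ?E (q * w)" "?E (q * w) = (1 - q * w) * ?E (q\<^sup>2 * w)"
      "?E (q\<^sup>2 * w) = (1 - q\<^sup>2 * w) * ?E (q ^ 3 * w)"
      using qpoch_inf_eq[OF q, of w] qpoch_inf_eq[OF q, of "q * w"] qpoch_inf_eq[OF q, of "q\<^sup>2 * w"]
      by (simp_all add: power2_eq_square power3_eq_cube mult_ac)
    have "?E w * ?F w = ?E (q * w) * ((1 - w) * ?F w)" by (simp add: E(1) mult_ac)
    also have "\<dots> = ((1 + d/q + e/q) - w * (a + b + c)) * (?E (q * w) * ?F (q * w))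
      + (w * (a*b + a*c + b*c) - (d/q + e/q + d*e/q\<^sup>2)) * (?E (q * w) * ?F (q\<^sup>2 * w))
      + (d*e/q\<^sup>2 - w * (a*b*c)) * (?E (q * w) * ?F (q ^ 3 * w))"
      unfolding phi32_series_q_difference[OF ok w] by algebra
    also have "?E (q * w) * ?F (q\<^sup>2 * w) = (1 - q * w) * (?E (q\<^sup>2 * w) * ?F (q\<^sup>2 * w))"
      by (simp add: E(2))
    also have "?E (q * w) * ?F (q ^ 3 * w)
        = (1 - q * w) * (1 - q\<^sup>2 * w) * (?E (q ^ 3 * w) * ?F (q ^ 3 * w))"
      by (simp add: E(2) E(3))
    finally show "?E w * ?F w =
      ((1 + d/q + e/q) - w * (a + b + c)) * (?E (q * w) * ?F (q * w))
      + (1 - q * w) * (w * (a*b + a*c + b*c) - (d/q + e/q + d*e/q\<^sup>2)) * (?E (q\<^sup>2 * w) * ?F (q\<^sup>2 * w))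
      + (1 - q * w) * (1 - q\<^sup>2 * w) * (d*e/q\<^sup>2 - w * (a*b*c)) * (?E (q ^ 3 * w) * ?F (q ^ 3 * w))"
      by (simp only: mult_ac)
  next
    fix G
    assume "G holomorphic_on UNIV" "\<And>w. norm w < 1 \<Longrightarrow> G w = ?E w * ?F w"
      and eq: "\<And>w. G w = ((1 + d/q + e/q) - w * (a + b + c)) * G (q * w)
        + (1 - q * w) * (w * (a*b + a*c + b*c) - (d/q + e/q + d*e/q\<^sup>2)) * G (q\<^sup>2 * w)
        + (1 - q * w) * (1 - q\<^sup>2 * w) * (d*e/q\<^sup>2 - w * (a*b*c)) * G (q ^ 3 * w)"
    then have "is_regularization q a b c d e G" unfolding is_regularization_def by blast
    then show ?thesis by blast
  qed (auto intro!: holomorphic_intros phi32_series_holomorphic qpoch_inf_holomorphic[OF q])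
  then show ?thesis unfolding phi32_reg_def by (rule someI_ex)
qed

lemmas phi32_reg_holomorphic =
    is_regularization_phi32_reg[unfolded is_regularization_def, THEN conjunct1]
  and phi32_reg_eq =
    is_regularization_phi32_reg[unfolded is_regularization_def, THEN conjunct2, THEN conjunct1, rule_format]
  and phi32_reg_q_difference =
    is_regularization_phi32_reg[unfolded is_regularization_def, THEN conjunct2, THEN conjunct2, rule_format]

lemma phi32_reg_0: "lower_ok q d e \<Longrightarrow> phi32_reg q a b c d e 0 = 1"
  by (simp add: phi32_reg_eq phi32_series_0 qpoch_inf_0[OF q])

text \<open>Resolves the \<open>THE\<close>: a quotient of entire functions is meromorphic,
  \<open>remove_sings\<close> makes it nicely so, and \<open>nicely_meromorphic_eqI\<close> excludes
  any other candidate.\<close>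

lemma phi32_eq_remove_sings:
  assumes ok: "lower_ok q d e"
  shows "phi32 q a b c d e = remove_sings (\<lambda>w. phi32_reg q a b c d e w / qpoch_inf q w)"
proof -
  let ?G = "phi32_reg q a b c d e"
  let ?f = "remove_sings (\<lambda>w. ?G w / qpoch_inf q w)"
  have G: "?G analytic_on A" for A
    using analytic_on_holomorphic[THEN iffD2] phi32_reg_holomorphic[OF ok] open_UNIV subset_UNIV by blast
  have E: "qpoch_inf q analytic_on A" for A
    using analytic_on_holomorphic[THEN iffD2] qpoch_inf_holomorphic[OF q] open_UNIV subset_UNIV by blast
  have nice: "?f nicely_meromorphic_on UNIV"
    by (intro remove_sings_nicely_meromorphic meromorphic_intros analytic_on_imp_meromorphic_on G E)
  have disc: "?f w = phi32_series q a b c d e w" if w: "norm w < 1" for w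
  proof -
    have nz: "qpoch_inf q w \<noteq> 0" by (rule qpoch_inf_nonzero_disc[OF q w])
    have "(\<lambda>w. ?G w / qpoch_inf q w) analytic_on {w}"
      by (intro analytic_intros G E) (use nz in auto)
    then show ?thesis using nz by (simp add: phi32_reg_eq[OF ok w])
  qed
  show ?thesis
    unfolding phi32_def phi32_series_def[symmetric]
  proof (rule the_equality)
    show "?f nicely_meromorphic_on UNIV \<and> (\<forall>w. norm w < 1 \<longrightarrow> ?f w = phi32_series q a b c d e w)"
      using nice disc by blast
    show "f = ?f" if "f nicely_meromorphic_on UNIV \<and> (\<forall>w. norm w < 1 \<longrightarrow> f w = phi32_series q a b c d e w)" for f
      by (rule nicely_meromorphic_eqI) (use that nice disc in auto)
  qed
qed

text \<open>The point w may be a zero of \<open>qpoch_inf q\<close>, so no division is possible. The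
  difference of the two sides vanishes in a punctured neighbourhood of w and is analytic at w, which
  is not a pole.\<close>

lemma phi32_reg_eq_mult_phi32:
  assumes ok: "lower_ok q d e" and pole: "\<not> is_pole (phi32 q a b c d e) w"
  shows "phi32_reg q a b c d e w = qpoch_inf q w * phi32 q a b c d e w"
proof -
  let ?G = "phi32_reg q a b c d e" and ?\<phi> = "phi32 q a b c d e"
  have G: "?G analytic_on A" for A
    using analytic_on_holomorphic[THEN iffD2] phi32_reg_holomorphic[OF ok] open_UNIV subset_UNIV by blast
  have E: "qpoch_inf q analytic_on A" for A
    using analytic_on_holomorphic[THEN iffD2] qpoch_inf_holomorphic[OF q] open_UNIV subset_UNIV by blast
  have nice: "?\<phi> nicely_meromorphic_on UNIV"
    unfolding phi32_eq_remove_sings[OF ok]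
    by (intro remove_sings_nicely_meromorphic meromorphic_intros analytic_on_imp_meromorphic_on G E)
  have disc: "?G u - qpoch_inf q u * ?\<phi> u = 0" if u: "norm u < 1" for u
  proof -
    have nz: "qpoch_inf q u \<noteq> 0" by (rule qpoch_inf_nonzero_disc[OF q u])
    have "(\<lambda>w. ?G w / qpoch_inf q w) analytic_on {u}"
      by (intro analytic_intros G E) (use nz in auto)
    then show ?thesis using nz by (simp add: phi32_eq_remove_sings[OF ok])
  qed
  have "(\<lambda>u. ?G u - qpoch_inf q u * ?\<phi> u) meromorphic_on UNIV"
    using nice unfolding nicely_meromorphic_on_def
    by (intro meromorphic_on_diff meromorphic_on_mult
        analytic_on_imp_meromorphic_on[OF G] analytic_on_imp_meromorphic_on[OF E]) blast
  from meromorphic_eventually_zero[OF this disc]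
  have ev: "eventually (\<lambda>u. ?G u - qpoch_inf q u * ?\<phi> u = 0) (at w)" .
  have "?\<phi> analytic_on {w}"
    using nice pole by (intro nicely_meromorphic_on_imp_analytic_at) auto
  then have "(\<lambda>u. ?G u - qpoch_inf q u * ?\<phi> u) analytic_on {w}"
    by (intro analytic_intros G E)
  then have "(\<lambda>u. ?G u - qpoch_inf q u * ?\<phi> u) \<midarrow>w\<rightarrow> ?G w - qpoch_inf q w * ?\<phi> w"
    using analytic_at_imp_isCont isContD by blast
  moreover have "(\<lambda>u. ?G u - qpoch_inf q u * ?\<phi> u) \<midarrow>w\<rightarrow> 0"
    using ev by (rule tendsto_eventually)
  ultimately have "?G w - qpoch_inf q w * ?\<phi> w = 0" by (rule LIM_unique)
  then show ?thesis by simp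
qed

end

section \<open>The contiguous relation\<close>

lemma qpoch_Suc: "qpoch q a (Suc k) = qpoch q a k * (1 - a * q ^ k)"
  by (simp add: qpoch_def)

lemma qpoch_Suc_shift: "qpoch q a (Suc k) = (1 - a) * qpoch q (a * q) k"
  by (induction k) (simp_all add: qpoch_def mult_ac)

text \<open>
  With t = q ^ k this is, up to the k-th coefficient of a contiguous series, the
  creative-telescoping certificate of the three-term relation in the proof of
  phi32_reg_contiguous.
\<close>

definition contig_cert ::
    "complex \<Rightarrow> complex \<Rightarrow> complex \<Rightarrow> complex \<Rightarrow> complex \<Rightarrow> complex \<Rightarrow> complex \<Rightarrow> complex" where
  "contig_cert q a b c x y t =
     (a*(x+y) - (b+c) + b*c - a*q*x*y)
     + q*(b*c - a\<^sup>2*x*y - a*b*c*(x+y) + a*q*x*y*(b+c)) * t + a*b*c*x*y*q\<^sup>2*(a-q) * t\<^sup>2"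

text \<open>The coefficient equation of \<open>phi32_coeff_contiguous\<close> at index k+1, with s =
  q^k, after removal of the common q-shifted factorials.\<close>

lemma contig_cert_identity:
  fixes q a b c x y s :: complex
  shows "a\<^sup>2*x*y*(1-q*x)*(1-q*y)*((1-b*(q* s))*(1-b*q*(q* s))*((1-c*(q* s))*(1-c*q*(q* s))))
    - (a\<^sup>2*x*y + q*b*c - a*q*b*c*(x+y) - a*q*x*y*(b+c) + (1+q)*q*a*b*c*x*y)
        * ((1-b*(q* s))*(1-c*(q* s))*(1-a*q*x*(q* s))*(1-a*q*y*(q* s)))
    + q*b*c*((1-b)*(1-c)*((1-a*q*x* s)*(1-a*q*x*(q* s)))*((1-a*q*y* s)*(1-a*q*y*(q* s))))
    = b*c*q*(contig_cert q a b c x y s * ((1-q* s)*(1-a*q*x*(q* s))*(1-a*q*y*(q* s))))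
    - a*x*y*q*(contig_cert q a b c x y (q* s) * ((1-a*(q* s))*(1-b*(q* s))*(1-c*(q* s))))"
  unfolding contig_cert_def by algebra

text \<open>The preceding identity at q*s = 1, where 1 - q*s removes the term of index -1, with the
  common factor (1-b)(1-c) taken out.\<close>

lemma contig_cert_identity_0:
  fixes q a b c x y :: complex
  shows "a\<^sup>2*x*y*(1-q*x)*(1-q*y)*((1-b*q)*(1-c*q))
    - (a\<^sup>2*x*y + q*b*c - a*q*b*c*(x+y) - a*q*x*y*(b+c) + (1+q)*q*a*b*c*x*y)
        * ((1-a*q*x)*(1-a*q*y))
    + q*b*c*((1-a*x)*(1-a*y)*((1-a*q*x)*(1-a*q*y)))
    = - (a*x*y*q*(1-a)*contig_cert q a b c x y 1)"
  unfolding contig_cert_def power_one mult_1_right by algebra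

text \<open>Here d = a*x and e = a*y, so de/(abc) = a*x*y/(b*c). Weighted with w^k, the right-hand
  sides sum to (b*c*w - a*x*y) times the series of \<rho>: the defect that vanishes at this
  argument.\<close>

lemma phi32_coeff_contiguous:
  fixes q a b c x y :: complex
  assumes q: "norm q < 1" and ok: "lower_ok q (a*x) (a*y)"
  defines "\<rho> \<equiv> \<lambda>k. q * (1-a) / ((1-a*q*x)*(1-a*q*y)) *
      (phi32_coeff q (a*q) (b*q) (c*q) (a*x*q*q) (a*y*q*q) k * contig_cert q a b c x y (q ^ k))"
  defines "l \<equiv> \<lambda>k. a\<^sup>2*x*y*(1-q*x)*(1-q*y)*((1-b*q)*(1-c*q)) / ((1-a*q*x)*(1-a*q*y)) *
        phi32_coeff q a (b*q*q) (c*q*q) (a*x*q*q) (a*y*q*q) k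
      - (a\<^sup>2*x*y + q*b*c - a*q*b*c*(x+y) - a*q*x*y*(b+c) + (1+q)*q*a*b*c*x*y) *
        phi32_coeff q a (b*q) (c*q) (a*x*q) (a*y*q) k
      + q*b*c*((1-a*x)*(1-a*y)) * phi32_coeff q a b c (a*x) (a*y) k"
  shows "l 0 = - (a*x*y * \<rho> 0)" and "l (Suc k) = b*c * \<rho> k - a*x*y * \<rho> (Suc k)"
proof -
  have nz: "a*x*q^j \<noteq> 1" "a*y*q^j \<noteq> 1" for j
    using ok by (simp_all add: lower_ok_def)
  have nz1: "1 - a*q*x \<noteq> 0" "1 - a*q*y \<noteq> 0" "1 - a*x \<noteq> 0" "1 - a*y \<noteq> 0"
    using nz[of 1] nz[of 0] by (simp_all add: mult_ac)
  have "l 0 = (a\<^sup>2*x*y*(1-q*x)*(1-q*y)*((1-b*q)*(1-c*q))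
    - (a\<^sup>2*x*y + q*b*c - a*q*b*c*(x+y) - a*q*x*y*(b+c) + (1+q)*q*a*b*c*x*y)
        * ((1-a*q*x)*(1-a*q*y))
    + q*b*c*((1-a*x)*(1-a*y)*((1-a*q*x)*(1-a*q*y)))) / ((1-a*q*x)*(1-a*q*y))"
    using nz1 by (simp add: l_def add_divide_distrib diff_divide_distrib)
  also have "\<dots> = - (a*x*y * \<rho> 0)"
    unfolding contig_cert_identity_0 by (simp add: \<rho>_def mult_ac)
  finally show "l 0 = - (a*x*y * \<rho> 0)" .

  have cancel: "N * (\<beta> * P) * (\<gamma> * R) / (X * Y * Z) = N * P * R / ((X * u) * (Y * v) * Z) * (\<beta> * \<gamma> * u * v)"
    if "u \<noteq> 0" "v \<noteq> 0" for N \<beta> P \<gamma> R X Y Z u v :: complex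
    using that by (simp add: mult_ac)
  have cancel': "\<gamma> * a1 / (e1 * e2) * (A * B * C / (X * Y * Z) * \<beta>)
      = a1 * A * B * C / ((e1 * X * u) * (e2 * Y * v) * (Z * w)) * (\<gamma> * (\<beta> * (w * u * v)))"
    if "u \<noteq> 0" "v \<noteq> 0" "w \<noteq> 0" for \<gamma> a1 e1 e2 A B C X Y Z u v w \<beta> :: complex
    using that by (simp add: mult_ac)
  define s where "s = q ^ k"
  let ?X = "qpoch q (a*x*q) (Suc (Suc k))" and ?Y = "qpoch q (a*y*q) (Suc (Suc k))"
  \<comment> \<open>Common upper factorials over the longest lower ones: each of the five terms
    below is \<open>M\<close> times a polynomial in s.\<close>
  define M where "M = qpoch q a (Suc k) * qpoch q (b*q) k * qpoch q (c*q) k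
      / (?X * ?Y * qpoch q q (Suc k))"
  have nz2: "1 - a*q*x*(q* s) \<noteq> 0" "1 - a*q*y*(q* s) \<noteq> 0" "1 - a*q*x* s \<noteq> 0" "1 - a*q*y* s \<noteq> 0"
      "1 - q* s \<noteq> 0"
    using nz[of "Suc (Suc k)"] nz[of "Suc k"] qpow_Suc_neq_1[OF q, of k]
    by (auto simp: s_def mult_ac)
  have c2: "(1-b*q)*(1-c*q) / ((1-a*q*x)*(1-a*q*y)) * phi32_coeff q a (b*q*q) (c*q*q) (a*x*q*q) (a*y*q*q) (Suc k)
      = M * ((1-b*(q* s))*(1-b*q*(q* s))*((1-c*(q* s))*(1-c*q*(q* s))))"
  proof -
    have num: "(1-b*q) * qpoch q (b*q*q) (Suc k) = qpoch q (b*q) k * (1-b*(q* s)) * (1-b*q*(q* s))" for b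
      unfolding qpoch_Suc_shift[symmetric] by (simp add: qpoch_Suc s_def mult_ac)
    have den: "?X = (1-a*q*x) * qpoch q (a*x*q*q) (Suc k)" "?Y = (1-a*q*y) * qpoch q (a*y*q*q) (Suc k)"
      by (simp_all only: qpoch_Suc_shift mult_ac)
    have "(1-b*q)*(1-c*q) / ((1-a*q*x)*(1-a*q*y)) * phi32_coeff q a (b*q*q) (c*q*q) (a*x*q*q) (a*y*q*q) (Suc k)
      = qpoch q a (Suc k) * ((1-b*q) * qpoch q (b*q*q) (Suc k)) * ((1-c*q) * qpoch q (c*q*q) (Suc k)) /
        (?X * ?Y * qpoch q q (Suc k))"
      unfolding den phi32_coeff_def by (simp add: mult_ac)
    then show ?thesis unfolding num M_def by (simp add: mult_ac)
  qed
  have c1: "phi32_coeff q a (b*q) (c*q) (a*x*q) (a*y*q) (Suc k)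
      = M * ((1-b*(q* s))*(1-c*(q* s))*(1-a*q*x*(q* s))*(1-a*q*y*(q* s)))"
  proof -
    have "?X = qpoch q (a*x*q) (Suc k) * (1-a*q*x*(q* s))" "?Y = qpoch q (a*y*q) (Suc k) * (1-a*q*y*(q* s))"
      by (simp_all only: qpoch_Suc[of _ _ "Suc k"] s_def power_Suc mult_ac)
    moreover have "qpoch q (b*q) (Suc k) = (1-b*(q* s)) * qpoch q (b*q) k" for b
      by (simp add: qpoch_Suc s_def mult_ac)
    ultimately show ?thesis
      unfolding M_def phi32_coeff_def by (simp only: cancel[OF nz2(1,2)])
  qed
  have c0: "(1-a*x)*(1-a*y) * phi32_coeff q a b c (a*x) (a*y) (Suc k)
      = M * ((1-b)*(1-c)*((1-a*q*x* s)*(1-a*q*x*(q* s)))*((1-a*q*y* s)*(1-a*q*y*(q* s))))"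
  proof -
    have num: "qpoch q b (Suc k) = (1-b) * qpoch q (b*q) k" for b
      by (rule qpoch_Suc_shift)
    have den: "?X = qpoch q (a*x*q) k * ((1-a*q*x* s) * (1-a*q*x*(q* s)))"
      "?Y = qpoch q (a*y*q) k * ((1-a*q*y* s) * (1-a*q*y*(q* s)))"
      by (simp_all add: qpoch_Suc s_def mult_ac)
    have "(1-a*x)*(1-a*y) * phi32_coeff q a b c (a*x) (a*y) (Suc k)
        = qpoch q a (Suc k) * ((1-b) * qpoch q (b*q) k) * ((1-c) * qpoch q (c*q) k)
          / (qpoch q (a*x*q) k * qpoch q (a*y*q) k * qpoch q q (Suc k))"
      using nz1 unfolding phi32_coeff_def num by (simp add: mult_ac)
    also have "\<dots> = M * ((1-b)*(1-c)*((1-a*q*x* s)*(1-a*q*x*(q* s)))*((1-a*q*y* s)*(1-a*q*y*(q* s))))"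
      unfolding M_def den
      using cancel[of "(1-a*q*x* s)*(1-a*q*x*(q* s))" "(1-a*q*y* s)*(1-a*q*y*(q* s))"] nz2 by simp
    finally show ?thesis .
  qed
  have r0: "\<rho> k = M * (q * (contig_cert q a b c x y s * ((1-q* s)*(1-a*q*x*(q* s))*(1-a*q*y*(q* s)))))"
  proof -
    have num: "qpoch q a (Suc k) = (1-a) * qpoch q (a*q) k" by (rule qpoch_Suc_shift)
    have den: "?X = (1-a*q*x) * qpoch q (a*x*q*q) k * (1-a*q*x*(q* s))"
      "?Y = (1-a*q*y) * qpoch q (a*y*q*q) k * (1-a*q*y*(q* s))"
      unfolding qpoch_Suc[of _ _ "Suc k"] qpoch_Suc_shift[of _ _ k] s_def power_Suc
      by (simp_all only: mult_ac)
    have Q: "qpoch q q (Suc k) = qpoch q q k * (1-q* s)" by (simp add: qpoch_Suc s_def)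
    show ?thesis
      unfolding \<rho>_def M_def phi32_coeff_def num den Q s_def[symmetric]
      by (rule cancel'[OF nz2(1,2,5)])
  qed
  have r1: "\<rho> (Suc k) = M * (q * (contig_cert q a b c x y (q* s) * ((1-a*(q* s))*(1-b*(q* s))*(1-c*(q* s)))))"
  proof -
    have num: "(1-a) * qpoch q (a*q) (Suc k) = qpoch q a (Suc k) * (1-a*(q* s))"
      unfolding qpoch_Suc_shift[symmetric] by (simp add: qpoch_Suc[of _ _ "Suc k"] s_def)
    have num2: "qpoch q (b*q) (Suc k) = qpoch q (b*q) k * (1-b*(q* s))" for b
      by (simp add: qpoch_Suc s_def mult_ac)
    have den: "?X = (1-a*q*x) * qpoch q (a*x*q*q) (Suc k)" "?Y = (1-a*q*y) * qpoch q (a*y*q*q) (Suc k)"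
      by (simp_all only: qpoch_Suc_shift mult_ac)
    have "\<rho> (Suc k) = q * contig_cert q a b c x y (q* s) * (((1-a) * qpoch q (a*q) (Suc k)) * qpoch q (b*q) (Suc k) * qpoch q (c*q) (Suc k))
       / (?X * ?Y * qpoch q q (Suc k))"
      unfolding den \<rho>_def phi32_coeff_def by (simp add: s_def mult_ac)
    then show ?thesis unfolding num num2[of b] num2[of c] M_def by (simp add: mult_ac)
  qed
  have "l (Suc k) = a\<^sup>2*x*y*(1-q*x)*(1-q*y) * ((1-b*q)*(1-c*q) / ((1-a*q*x)*(1-a*q*y)) *
        phi32_coeff q a (b*q*q) (c*q*q) (a*x*q*q) (a*y*q*q) (Suc k))
      - (a\<^sup>2*x*y + q*b*c - a*q*b*c*(x+y) - a*q*x*y*(b+c) + (1+q)*q*a*b*c*x*y) *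
        phi32_coeff q a (b*q) (c*q) (a*x*q) (a*y*q) (Suc k)
      + q*b*c*((1-a*x)*(1-a*y) * phi32_coeff q a b c (a*x) (a*y) (Suc k))"
    unfolding l_def by (simp add: mult_ac)
  also have "\<dots> = M * (b*c*q*(contig_cert q a b c x y s * ((1-q* s)*(1-a*q*x*(q* s))*(1-a*q*y*(q* s))))
    - a*x*y*q*(contig_cert q a b c x y (q* s) * ((1-a*(q* s))*(1-b*(q* s))*(1-c*(q* s)))))"
    unfolding c2 c1 c0 contig_cert_identity[symmetric] by algebra
  also have "\<dots> = b*c * \<rho> k - a*x*y * \<rho> (Suc k)"
    unfolding r0 r1 by algebra
  finally show "l (Suc k) = b*c * \<rho> k - a*x*y * \<rho> (Suc k)" .
qed

lemma lower_ok_mult_q: "lower_ok q d e \<Longrightarrow> lower_ok q (d * q) (e * q)"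
  unfolding lower_ok_def by (metis mult.assoc power_Suc)

context
  fixes q :: complex
  assumes q: "norm q < 1" and q0: "q \<noteq> 0"
begin

lemma phi32_reg_contiguous:
  fixes a b c x y :: complex
  assumes ok: "lower_ok q (a*x) (a*y)" and b: "b \<noteq> 0" and c: "c \<noteq> 0"
  shows "a\<^sup>2*x*y*(1-q*x)*(1-q*y)*((1-b*q)*(1-c*q)) / ((1-a*q*x)*(1-a*q*y)) *
        phi32_reg q a (b*q*q) (c*q*q) (a*x*q*q) (a*y*q*q) (a*x*y/(b*c))
      - (a\<^sup>2*x*y + q*b*c - a*q*b*c*(x+y) - a*q*x*y*(b+c) + (1+q)*q*a*b*c*x*y) *
        phi32_reg q a (b*q) (c*q) (a*x*q) (a*y*q) (a*x*y/(b*c))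
      + q*b*c*((1-a*x)*(1-a*y)) * phi32_reg q a b c (a*x) (a*y) (a*x*y/(b*c)) = 0"
    (is "?\<alpha> * _ - ?S * _ + ?\<beta> * _ = 0")
proof -
  have ok1: "lower_ok q (a*x*q) (a*y*q)" by (rule lower_ok_mult_q[OF ok])
  have ok2: "lower_ok q (a*x*q*q) (a*y*q*q)" by (rule lower_ok_mult_q[OF ok1])
  let ?G0 = "phi32_reg q a b c (a*x) (a*y)"
  let ?G1 = "phi32_reg q a (b*q) (c*q) (a*x*q) (a*y*q)"
  let ?G2 = "phi32_reg q a (b*q*q) (c*q*q) (a*x*q*q) (a*y*q*q)"
  let ?G3 = "phi32_reg q (a*q) (b*q) (c*q) (a*x*q*q) (a*y*q*q)"
  let ?F0 = "phi32_series q a b c (a*x) (a*y)"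
  let ?F1 = "phi32_series q a (b*q) (c*q) (a*x*q) (a*y*q)"
  let ?F2 = "phi32_series q a (b*q*q) (c*q*q) (a*x*q*q) (a*y*q*q)"
  let ?F3 = "phi32_series q (a*q) (b*q) (c*q) (a*x*q*q) (a*y*q*q)"
  let ?c0 = "phi32_coeff q a b c (a*x) (a*y)"
  let ?c1 = "phi32_coeff q a (b*q) (c*q) (a*x*q) (a*y*q)"
  let ?c2 = "phi32_coeff q a (b*q*q) (c*q*q) (a*x*q*q) (a*y*q*q)"
  let ?c3 = "phi32_coeff q (a*q) (b*q) (c*q) (a*x*q*q) (a*y*q*q)"
  let ?E = "qpoch_inf q"
  define K where "K = q * (1-a) / ((1-a*q*x)*(1-a*q*y))"
  define p0 where "p0 = a*(x+y) - (b+c) + b*c - a*q*x*y"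
  define p1 where "p1 = q*(b*c - a\<^sup>2*x*y - a*b*c*(x+y) + a*q*x*y*(b+c))"
  define p2 where "p2 = a*b*c*x*y*q\<^sup>2*(a-q)"
  define \<rho> where "\<rho> k = K * (?c3 k * contig_cert q a b c x y (q ^ k))" for k
  define l where "l k = ?\<alpha> * ?c2 k - ?S * ?c1 k + ?\<beta> * ?c0 k" for k
  have l: "l 0 = - (a*x*y * \<rho> 0)" "l (Suc k) = b*c * \<rho> k - a*x*y * \<rho> (Suc k)" for k
    unfolding l_def \<rho>_def K_def by (rule phi32_coeff_contiguous[OF q ok])+
  \<comment> \<open>The certificate is quadratic in \<open>q ^ k\<close>, hence three dilates. The
    factors 1-w and (1-w)(1-q*w) turn \<open>qpoch_inf\<close> at q*w and q^2*w back into its value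
    at w, so on the disc \<open>R w\<close> is \<open>qpoch_inf q w\<close> times the series of
    \<rho>.\<close>
  define R where "R w = K * (p0 * ?G3 w + p1 * ((1-w) * ?G3 (q*w))
      + p2 * ((1-w) * (1-q*w) * ?G3 (q\<^sup>2*w)))" for w
  have series: "?\<alpha> * ?G2 w - ?S * ?G1 w + ?\<beta> * ?G0 w = (b*c*w - a*x*y) * R w"
    if w: "norm w < 1" for w
  proof -
    define r where "r = K * (p0 * ?F3 w + p1 * ?F3 (q*w) + p2 * ?F3 (q\<^sup>2*w))"
    have "(\<lambda>k. K * (?c3 k * (p0 + p1 * q ^ k + p2 * (q ^ k)\<^sup>2 + 0 * (q ^ k) ^ 3) * w ^ k)) sums
        (K * (p0 * ?F3 w + p1 * ?F3 (q*w) + p2 * ?F3 (q\<^sup>2*w) + 0 * ?F3 (q^3*w)))"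
      by (intro sums_mult phi32_series_poly_sums[OF q q0 w])
    then have \<rho>: "(\<lambda>k. \<rho> k * w ^ k) sums r"
      by (simp add: \<rho>_def r_def contig_cert_def p0_def p1_def p2_def mult_ac)
    have L: "(\<lambda>k. l k * w ^ k) sums (?\<alpha> * ?F2 w - ?S * ?F1 w + ?\<beta> * ?F0 w)"
    proof -
      have "(\<lambda>k. ?\<alpha> * (?c2 k * w ^ k) - ?S * (?c1 k * w ^ k) + ?\<beta> * (?c0 k * w ^ k)) sums
          (?\<alpha> * ?F2 w - ?S * ?F1 w + ?\<beta> * ?F0 w)"
        by (intro sums_add sums_diff sums_mult phi32_series_sums[OF q q0 w])
      moreover have "?\<alpha> * (?c2 k * w ^ k) - ?S * (?c1 k * w ^ k) + ?\<beta> * (?c0 k * w ^ k) = l k * w ^ k" for k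
        unfolding l_def by (simp only: ring_distribs mult.assoc)
      ultimately show ?thesis by simp
    qed
    have "(\<lambda>k. l k * w ^ k + a*x*y * (\<rho> k * w ^ k)) sums (b*c*w * r + (l 0 * w ^ 0 + a*x*y * (\<rho> 0 * w ^ 0)))"
    proof (rule sums_Suc)
      have "(\<lambda>k. b*c*w * (\<rho> k * w ^ k)) sums (b*c*w * r)" by (intro sums_mult \<rho>)
      moreover have "b*c*w * (\<rho> k * w ^ k) = l (Suc k) * w ^ Suc k + a*x*y * (\<rho> (Suc k) * w ^ Suc k)" for k
        by (simp add: l ring_distribs mult_ac)
      ultimately show "(\<lambda>k. l (Suc k) * w ^ Suc k + a*x*y * (\<rho> (Suc k) * w ^ Suc k)) sums (b*c*w * r)"
        by simp
    qed
    moreover have "l 0 * w ^ 0 + a*x*y * (\<rho> 0 * w ^ 0) = 0" by (simp add: l)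
    moreover have "(\<lambda>k. l k * w ^ k + a*x*y * (\<rho> k * w ^ k)) sums
        (?\<alpha> * ?F2 w - ?S * ?F1 w + ?\<beta> * ?F0 w + a*x*y * r)"
      by (intro sums_add L sums_mult \<rho>)
    ultimately have "?\<alpha> * ?F2 w - ?S * ?F1 w + ?\<beta> * ?F0 w + a*x*y * r = b*c*w * r"
      using sums_unique2 by fastforce
    then have F: "?\<alpha> * ?F2 w - ?S * ?F1 w + ?\<beta> * ?F0 w = (b*c*w - a*x*y) * r"
      by (simp only: left_diff_distrib eq_diff_eq)
    have E: "?E w = (1-w) * ?E (q*w)" "?E w = (1-w) * (1-q*w) * ?E (q\<^sup>2*w)"
      using qpoch_inf_eq[OF q, of w] qpoch_inf_eq[OF q, of "q*w"]
      by (simp_all add: power2_eq_square mult_ac)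
    have w12: "norm (q*w) < 1" "norm (q\<^sup>2*w) < 1"
      using norm_qpow_mult_less[OF q q0 w, of 1] norm_qpow_mult_less[OF q q0 w, of 2] by simp_all
    have "R w = K * (p0 * (?E w * ?F3 w) + p1 * ((1-w) * ?E (q*w) * ?F3 (q*w))
        + p2 * ((1-w) * (1-q*w) * ?E (q\<^sup>2*w) * ?F3 (q\<^sup>2*w)))"
      unfolding R_def phi32_reg_eq[OF q q0 ok2 w] phi32_reg_eq[OF q q0 ok2 w12(1)]
        phi32_reg_eq[OF q q0 ok2 w12(2)] by (simp only: mult.assoc)
    also have "\<dots> = ?E w * r"
      unfolding E(1)[symmetric] E(2)[symmetric] r_def by algebra
    finally have R: "R w = ?E w * r" .
    have "?\<alpha> * ?G2 w - ?S * ?G1 w + ?\<beta> * ?G0 w = ?E w * (?\<alpha> * ?F2 w - ?S * ?F1 w + ?\<beta> * ?F0 w)"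
      unfolding phi32_reg_eq[OF q q0 ok w] phi32_reg_eq[OF q q0 ok1 w] phi32_reg_eq[OF q q0 ok2 w]
      by (simp only: ring_distribs mult_ac)
    also have "\<dots> = (b*c*w - a*x*y) * R w"
      unfolding F R by (simp only: mult_ac)
    finally show ?thesis .
  qed
  have comp: "(\<lambda>w. ?G3 (u * w)) holomorphic_on UNIV" for u
    by (rule holomorphic_on_compose_gen[OF _ phi32_reg_holomorphic[OF q q0 ok2], unfolded o_def])
      (auto intro!: holomorphic_intros)
  \<comment> \<open>Both sides are entire, so the relation may be evaluated at w = a*x*y/(b*c) of
    any modulus, where the right-hand side is 0.\<close>
  have "?\<alpha> * ?G2 w - ?S * ?G1 w + ?\<beta> * ?G0 w = (b*c*w - a*x*y) * R w" for w
  proof (rule entire_eqI[of "\<lambda>w. ?\<alpha> * ?G2 w - ?S * ?G1 w + ?\<beta> * ?G0 w" "\<lambda>w. (b*c*w - a*x*y) * R w"])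
    show "(\<lambda>w. ?\<alpha> * ?G2 w - ?S * ?G1 w + ?\<beta> * ?G0 w) holomorphic_on UNIV"
      by (intro holomorphic_on_add holomorphic_on_diff holomorphic_on_mult holomorphic_on_const
          phi32_reg_holomorphic[OF q q0] ok ok1 ok2)
    show "(\<lambda>w. (b*c*w - a*x*y) * R w) holomorphic_on UNIV"
      unfolding R_def
      by (intro holomorphic_on_add holomorphic_on_diff holomorphic_on_mult holomorphic_on_const
          holomorphic_on_ident phi32_reg_holomorphic[OF q q0 ok2] comp)
  qed (rule series)
  from this[of "a*x*y/(b*c)"] show ?thesis using b c by simp
qed

section \<open>The limit of the regularised functions\<close>

text \<open>Tannery's theorem gives convergence on a small disc around 0. The q-difference equation,
  whose coefficients converge as well, carries it outwards by a factor 1/|q| at a time.\<close>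

lemma phi32_reg_tendsto:
  fixes a w :: complex and b c d e :: "nat \<Rightarrow> complex"
  assumes ok: "\<And>n. lower_ok q (d n) (e n)"
    and b: "b \<longlonglongrightarrow> 0" and c: "c \<longlonglongrightarrow> 0" and d: "d \<longlonglongrightarrow> 0" and e: "e \<longlonglongrightarrow> 0"
  shows "(\<lambda>n. phi32_reg q a (b n) (c n) (d n) (e n) w) \<longlonglongrightarrow> phi32_reg q a 0 0 0 0 w"
proof -
  let ?G = "\<lambda>n. phi32_reg q a (b n) (c n) (d n) (e n)" and ?G' = "phi32_reg q a 0 0 0 0"
  let ?c = "\<lambda>n. phi32_coeff q a (b n) (c n) (d n) (e n)" and ?c' = "phi32_coeff q a 0 0 0 0"
  let ?\<rho> = "\<lambda>n. phi32_ratio q a (b n) (c n) (d n) (e n)" and ?\<rho>' = "phi32_ratio q a 0 0 0 0"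
  have ok': "lower_ok q 0 0" by (simp add: lower_ok_def)
  have ratio_lim: "(\<lambda>n. ?\<rho> n k) \<longlonglongrightarrow> ?\<rho>' k" for k
    unfolding phi32_ratio_def
    by (intro tendsto_intros b c d e) (use qpow_Suc_neq_1[OF q, of k] in auto)
  have coeff_lim: "(\<lambda>n. ?c n k) \<longlonglongrightarrow> ?c' k" for k
  proof (induction k)
    case (Suc k)
    then show ?case unfolding phi32_coeff_Suc by (intro tendsto_intros ratio_lim)
  qed simp
  \<comment> \<open>A bound for the coefficient ratios, uniform in k and in all large n: there |b
    n|, |c n| < 1 and |d n|, |e n| < 1/2, so the lower factors stay away from 0.\<close>
  define M where "M = (1 + norm a) * 2 * 2 / ((1/2) * (1/2) * (1 - norm q))"
  have M: "M > 0" unfolding M_def using q by (intro divide_pos_pos mult_pos_pos) (auto simp: add_pos_nonneg)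
  have qk: "norm (u * q ^ k) \<le> norm u" for u k
    using q by (simp add: norm_mult norm_power mult_right_le_one_le power_le_one)
  have upper: "norm (1 - u * q ^ k) \<le> 1 + norm u" for u k
    using norm_triangle_ineq4[of 1 "u * q ^ k"] qk[of u k] by simp
  have lower: "norm (1 - u * q ^ k) \<ge> 1 - norm u" for u k
    using norm_triangle_ineq2[of 1 "u * q ^ k"] qk[of u k] by simp
  have "eventually (\<lambda>n. norm (b n) < 1) sequentially" "eventually (\<lambda>n. norm (c n) < 1) sequentially"
    "eventually (\<lambda>n. norm (d n) < 1/2) sequentially" "eventually (\<lambda>n. norm (e n) < 1/2) sequentially"
    by (rule order_tendstoD(2)[OF tendsto_norm_zero], rule b c d e, simp)+
  then have bound: "eventually (\<lambda>n. \<forall>k. norm (?c n k) \<le> M ^ k) sequentially"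
  proof eventually_elim
    case (elim n)
    have ratio: "norm (?\<rho> n k) \<le> M" for k
      unfolding phi32_ratio_def norm_divide norm_mult M_def
    proof (rule frac_le)
      have "norm (1 - b n * q ^ k) \<le> 2" "norm (1 - c n * q ^ k) \<le> 2"
        using upper[of "b n" k] upper[of "c n" k] elim by auto
      then show "norm (1 - a * q ^ k) * norm (1 - b n * q ^ k) * norm (1 - c n * q ^ k) \<le> (1 + norm a) * 2 * 2"
        by (intro mult_mono upper) (auto intro!: mult_nonneg_nonneg add_nonneg_nonneg)
      have "norm (1 - d n * q ^ k) \<ge> 1/2" "norm (1 - e n * q ^ k) \<ge> 1/2"
        using lower[of "d n" k] lower[of "e n" k] elim by auto
      then show "1/2 * (1/2) * (1 - norm q)
          \<le> norm (1 - d n * q ^ k) * norm (1 - e n * q ^ k) * norm (1 - q * q ^ k)"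
        using q by (intro mult_mono lower) auto
    qed (use q in auto)
    have "norm (?c n k) \<le> M ^ k" for k
    proof (induction k)
      case (Suc k)
      then show ?case unfolding phi32_coeff_Suc norm_mult power_Suc
        using ratio M by (intro mult_mono) auto
    qed simp
    then show ?case by blast
  qed
  define r where "r = min 1 (1 / M)"
  have r: "r > 0" using M by (simp add: r_def)
  have base: "(\<lambda>n. ?G n w) \<longlonglongrightarrow> ?G' w" if w: "norm w < r" for w
  proof -
    have w1: "norm w < 1" and w2: "norm w < 1 / M" using w by (simp_all add: r_def)
    have "(\<lambda>n. \<Sum>k. ?c n k * w ^ k) \<longlonglongrightarrow> (\<Sum>k. ?c' k * w ^ k)"
    proof (rule tannerys_theorem[THEN conjunct2, THEN conjunct2])
      show "(\<lambda>n. ?c n k * w ^ k) \<longlonglongrightarrow> ?c' k * w ^ k" for k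
        by (intro tendsto_intros coeff_lim)
      show "summable (\<lambda>k. (M * norm w) ^ k)"
        using w2 M by (intro summable_geometric) (auto simp: field_simps)
      have "eventually (\<lambda>p. True \<and> (\<forall>k. norm (?c (snd p) k) \<le> M ^ k)) (at_top \<times>\<^sub>F sequentially)"
        by (rule eventually_prodI[OF always_eventually bound]) simp
      then show "eventually (\<lambda>(k, n). norm (?c n k * w ^ k) \<le> (M * norm w) ^ k) (at_top \<times>\<^sub>F sequentially)"
        by eventually_elim (auto simp: norm_mult norm_power power_mult_distrib intro!: mult_right_mono)
    qed simp
    then have "(\<lambda>n. qpoch_inf q w * phi32_series q a (b n) (c n) (d n) (e n) w)
        \<longlonglongrightarrow> qpoch_inf q w * phi32_series q a 0 0 0 0 w"
      unfolding phi32_series_def by (intro tendsto_intros)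
    then show ?thesis
      unfolding phi32_reg_eq[OF q q0 ok w1] phi32_reg_eq[OF q q0 ok' w1] .
  qed
  have step: "(\<lambda>n. ?G n w) \<longlonglongrightarrow> ?G' w" if "norm (q ^ m * w) < r" for m w
    using that
  proof (induction m arbitrary: w)
    case 0
    then show ?case using base by simp
  next
    case (Suc m)
    have *: "norm (q ^ m * (q ^ Suc i * w)) < r" for i
    proof -
      have "norm (q ^ m * (q ^ Suc i * w)) = norm (q ^ Suc m * w * q ^ i)" by (simp add: mult_ac)
      then show ?thesis using qk[of "q ^ Suc m * w" i] Suc.prems by linarith
    qed
    have IH: "(\<lambda>n. ?G n (q * w)) \<longlonglongrightarrow> ?G' (q * w)" "(\<lambda>n. ?G n (q\<^sup>2 * w)) \<longlonglongrightarrow> ?G' (q\<^sup>2 * w)"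
      "(\<lambda>n. ?G n (q ^ 3 * w)) \<longlonglongrightarrow> ?G' (q ^ 3 * w)"
      using *[of 0] *[of 1] *[of 2]
      by (auto intro!: Suc.IH simp: power2_eq_square power3_eq_cube mult_ac)
    show ?case
      unfolding phi32_reg_q_difference[OF q q0 ok, where w = w]
        phi32_reg_q_difference[OF q q0 ok', where w = w]
      by (intro tendsto_intros b c d e IH) (use q0 in auto)
  qed
  have "(\<lambda>n. norm (w * q ^ n)) \<longlonglongrightarrow> 0"
    using tendsto_norm[OF tendsto_geometric_zero[OF q, of w]] by simp
  from order_tendstoD(2)[OF this r] obtain m where "norm (q ^ m * w) < r"
    by (auto simp: eventually_sequentially mult_ac)
  then show ?thesis by (rule step)
qed

text \<open>With b = c = d = e = 0 the third-order q-difference equation collapses to G w = (1 -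
  a*w) * G (q*w).\<close>

lemma phi32_reg_limit_nonzero:
  assumes "norm (a * w) < 1"
  shows "phi32_reg q a 0 0 0 0 w \<noteq> 0"
proof (rule nonzero_of_q_difference_equation[OF q, where g = "phi32_reg q a 0 0 0 0" and c = a])
  have ok: "lower_ok q 0 0" by (simp add: lower_ok_def)
  show "isCont (phi32_reg q a 0 0 0 0) 0"
    using holomorphic_on_imp_continuous_on[OF phi32_reg_holomorphic[OF q q0 ok]]
    by (simp add: continuous_on_eq_continuous_at)
  show "phi32_reg q a 0 0 0 0 0 \<noteq> 0" by (simp add: phi32_reg_0[OF q q0 ok])
  show "phi32_reg q a 0 0 0 0 u = (1 - a * u) * phi32_reg q a 0 0 0 0 (q * u)" for u
    by (subst phi32_reg_q_difference[OF q q0 ok]) (simp add: mult_ac)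
  show "a * w * q ^ j \<noteq> 1" for j by (rule mult_qpow_neq_1[OF q assms])
qed

end

section \<open>The value of the continued fraction\<close>

theorem mainTheorem3:
  fixes q A B C D z x \<alpha> s lam_p lam_m :: complex
    and a b :: "nat \<Rightarrow> complex"
  assumes q: "0 < norm q" "norm q < 1"
    and nonzero: "A \<noteq> 0" "B \<noteq> 0" "C \<noteq> 0" "D \<noteq> 0"
    and a: "\<And>n. a n = (1/A + 1/B + 1/C + 1/D) * q ^ n - (1 + q) * q powi (2 * int n - 1)"
    and b: "\<And>n. n > 0 \<Longrightarrow> (b n)\<^sup>2 = q / (A*B*C*D) *
              (1 - A * q ^ (n-1)) * (1 - B * q ^ (n-1)) * (1 - C * q ^ (n-1)) * (1 - D * q ^ (n-1))"
    and b_nonzero: "\<And>n. n > 0 \<Longrightarrow> (b n)\<^sup>2 \<noteq> 0"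
    and \<alpha>: "(2 * \<alpha>)\<^sup>2 = A*B*C*D / q"
    and x: "x = \<alpha> * z" "x \<notin> complex_of_real ` {-1..1}"
    and s: "s\<^sup>2 = x\<^sup>2 - 1"
    and lam_p: "lam_p = 1 / (2 * \<alpha>) * (x + s)"
    and lam_m: "lam_m = 1 / (2 * \<alpha>) * (x - s)"
    and branch: "norm (lam_m / lam_p) < 1"
    and num_defined: "phi32_defined q (B*C*lam_m) B C (B*C*D*lam_m) (A*B*C*lam_m) (A*D*lam_m)"
    and den_defined:
      "phi32_defined q (B*C*lam_m) (B/q) (C/q) (B*C*D*lam_m/q) (A*B*C*lam_m/q) (A*D*lam_m)"
    and den_nonzero: "1 - B*C*D*lam_m/q \<noteq> 0" "1 - A*B*C*lam_m/q \<noteq> 0"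
      "phi32 q (B*C*lam_m) (B/q) (C/q) (B*C*D*lam_m/q) (A*B*C*lam_m/q) (A*D*lam_m) \<noteq> 0"
  shows "cf_has_value (\<lambda>n. if n = 0 then 1 else - (b n)\<^sup>2) (\<lambda>n. z - a n)
    (A*B*C*D*lam_m / (q * (1 - B*C*D*lam_m/q) * (1 - A*B*C*lam_m/q)) *
     (phi32 q (B*C*lam_m) B C (B*C*D*lam_m) (A*B*C*lam_m) (A*D*lam_m) /
      phi32 q (B*C*lam_m) (B/q) (C/q) (B*C*D*lam_m/q) (A*B*C*lam_m/q) (A*D*lam_m)))"
proof -
  define P where "P = A * B * C * D"
  define d where "d = B * C * D * lam_m"
  define e where "e = A * B * C * lam_m"
  define w where "w = A * D * lam_m"
  have q0: "q \<noteq> 0" using q by auto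
  have P: "P \<noteq> 0" using nonzero by (simp add: P_def)
  have \<alpha>0: "\<alpha> \<noteq> 0" using \<alpha> P q0 by (auto simp: P_def)
  have sum: "lam_p + lam_m = z"
    using \<alpha>0 by (simp add: lam_p lam_m x(1) field_simps)
  have prod: "lam_p * lam_m = q / P"
  proof -
    have "lam_p * lam_m = (x\<^sup>2 - s\<^sup>2) / (2 * \<alpha>)\<^sup>2"
      by (simp add: lam_p lam_m power2_eq_square field_simps)
    also have "\<dots> = q / P" unfolding s \<alpha> by (simp add: P_def)
    finally show ?thesis .
  qed
  have lam0: "lam_p \<noteq> 0" "lam_m \<noteq> 0" using prod q0 P by auto
  have lam_p_eq: "lam_p = q / (P * lam_m)" using prod lam0 P by (simp add: field_simps)
  have upper: "A * q ^ j \<noteq> 1" "B * q ^ j \<noteq> 1" "C * q ^ j \<noteq> 1" "D * q ^ j \<noteq> 1" for j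
    using b_nonzero[of "Suc j"] b[of "Suc j"] by auto
  have de_ok: "d / q * q ^ j \<noteq> 1" "e / q * q ^ j \<noteq> 1" for j
    using den_defined q0 by (auto simp: phi32_defined_def d_def e_def field_simps)
  have de_nz: "d * q ^ j \<noteq> 1" "e * q ^ j \<noteq> 1" for j
    using de_ok[of "Suc j"] q0 by simp_all
  \<comment> \<open>The lower parameters are written as a*x and a*y with x = D*q^n/q, y = A*q^n/q,
    the shape of \<open>phi32_reg_contiguous\<close>.\<close>
  define \<Gamma> where "\<Gamma> n = phi32_reg q (B*C*lam_m) (B * q^n / q) (C * q^n / q)
      (B*C*lam_m * (D * q^n / q)) (B*C*lam_m * (A * q^n / q)) w" for n
  have de_eq: "B*C*lam_m * (D * q^n / q) = d / q * q ^ n" "B*C*lam_m * (A * q^n / q) = e / q * q ^ n" for n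
    by (simp_all add: d_def e_def)
  have ok: "lower_ok q (B*C*lam_m * (D * q^n / q)) (B*C*lam_m * (A * q^n / q))" for n
    unfolding lower_ok_def de_eq using de_ok[of "n + _"] by (simp add: power_add mult_ac)

  have rec: "lam_m * ((1 - A*q^n) * (1 - B*q^n) * (1 - C*q^n) * (1 - D*q^n)) / ((1 - d*q^n) * (1 - e*q^n)) * \<Gamma> (Suc (Suc n))
      = (z - a n) * \<Gamma> (Suc n) - lam_p * ((1 - d/q*q^n) * (1 - e/q*q^n)) * \<Gamma> n" for n
  proof -
    define Q where "Q = q ^ n"
    let ?a = "B*C*lam_m" and ?b = "B*Q/q" and ?c = "C*Q/q" and ?x = "D*Q/q" and ?y = "A*Q/q"
    \<comment> \<open>The common factor of the contiguous relation, fixed by a^2*x*y = K*lam_m and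
      q*b*c = K*lam_p; this is where both roots enter.\<close>
    define K where "K = lam_m * P * B * C * (Q / q)\<^sup>2"
    have Q0: "Q \<noteq> 0" using q0 by (simp add: Q_def)
    have K0: "K \<noteq> 0" using lam0 P nonzero q0 Q0 by (simp add: K_def)
    have lin: "x2 * g2 = x1 * g1 - x0 * g0"
      if "u2 * g2 - u1 * g1 + u0 * g0 = 0" "u2 = K * x2" "u1 = K * x1" "u0 = K * x0"
      for u0 u1 u2 x0 x1 x2 g0 g1 g2 :: complex
    proof -
      have "K * (x2 * g2 - x1 * g1 + x0 * g0) = 0" using that by (simp add: algebra_simps)
      then have "x2 * g2 - x1 * g1 + x0 * g0 = 0" using K0 by simp
      then show ?thesis by algebra
    qed
    have w: "?a * ?x * ?y / (?b * ?c) = w"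
      using nonzero q0 Q0 by (simp add: w_def)
    have "?a\<^sup>2*?x*?y*(1-q*?x)*(1-q*?y)*((1-?b*q)*(1-?c*q)) / ((1-?a*q*?x)*(1-?a*q*?y)) * \<Gamma> (Suc (Suc n))
      - (?a\<^sup>2*?x*?y + q*?b*?c - ?a*q*?b*?c*(?x+?y) - ?a*q*?x*?y*(?b+?c) + (1+q)*q*?a*?b*?c*?x*?y) * \<Gamma> (Suc n)
      + q*?b*?c*((1-?a*?x)*(1-?a*?y)) * \<Gamma> n = 0"
    proof -
      have "\<Gamma> (Suc (Suc n)) = phi32_reg q ?a (?b*q*q) (?c*q*q) (?a*?x*q*q) (?a*?y*q*q) (?a*?x*?y/(?b*?c))"
        "\<Gamma> (Suc n) = phi32_reg q ?a (?b*q) (?c*q) (?a*?x*q) (?a*?y*q) (?a*?x*?y/(?b*?c))"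
        "\<Gamma> n = phi32_reg q ?a ?b ?c (?a*?x) (?a*?y) (?a*?x*?y/(?b*?c))"
        unfolding w unfolding \<Gamma>_def Q_def using q0 by (simp_all add: mult_ac)
      then show ?thesis
        using phi32_reg_contiguous[OF q(2) q0 ok[of n, folded Q_def], of ?b ?c] nonzero q0 Q0
        by simp
    qed
    moreover have "?a\<^sup>2*?x*?y*(1-q*?x)*(1-q*?y)*((1-?b*q)*(1-?c*q)) / ((1-?a*q*?x)*(1-?a*q*?y))
        = K * (lam_m * ((1 - A*Q) * (1 - B*Q) * (1 - C*Q) * (1 - D*Q)) / ((1 - d*Q) * (1 - e*Q)))"
    proof -
      have "?a\<^sup>2*?x*?y = K * lam_m" by (simp add: K_def P_def power2_eq_square)
      moreover have "1 - q*?x = 1 - D*Q" "1 - q*?y = 1 - A*Q" "1-?b*q = 1 - B*Q" "1-?c*q = 1-C*Q"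
        "1 - ?a*q*?x = 1 - d*Q" "1 - ?a*q*?y = 1 - e*Q"
        using q0 by (simp_all add: d_def e_def)
      ultimately show ?thesis by (simp only: mult_ac times_divide_eq_right)
    qed
    \<comment> \<open>The first two summands give K*(lam_m + lam_p) = K*z. Divided by K, the x+y
      term gives -(1/A+1/D)*Q, the b+c term -(1/B+1/C)*Q, and the last one (1+q)*Q^2/q.\<close>
    moreover have "?a\<^sup>2*?x*?y + q*?b*?c - ?a*q*?b*?c*(?x+?y) - ?a*q*?x*?y*(?b+?c) + (1+q)*q*?a*?b*?c*?x*?y
        = K * (z - a n)"
    proof -
      have "q powi (2 * int n - 1) = Q\<^sup>2 / q"
      proof -
        have "q powi (2 * int n - 1) = q powi (2 * int n) / q" using q0 by (simp add: power_int_diff)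
        also have "q powi (2 * int n) = Q\<^sup>2"
          using power_int_of_nat[of q "n * 2"] by (simp add: Q_def power_mult mult.commute)
        finally show ?thesis .
      qed
      then have za: "z - a n = lam_m + q / (P * lam_m) - (1/A + 1/B + 1/C + 1/D) * Q + (1 + q) * (Q\<^sup>2 / q)"
        by (simp add: a Q_def flip: sum lam_p_eq)
      show ?thesis
        unfolding za K_def P_def using lam0 nonzero q0
        by (simp add: power2_eq_square field_simps)
    qed
    moreover have "q*?b*?c*((1-?a*?x)*(1-?a*?y)) = K * (lam_p * ((1 - d/q*Q) * (1 - e/q*Q)))"
    proof -
      have "q*?b*?c = K * lam_p" using lam0 P by (simp add: K_def lam_p_eq power2_eq_square)
      then show ?thesis by (simp add: d_def e_def mult_ac)
    qed
    ultimately show ?thesis unfolding Q_def[symmetric] by (rule lin)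
  qed

  define \<Gamma>' where "\<Gamma>' = phi32_reg q (B*C*lam_m) 0 0 0 0 w"
  have \<Gamma>_lim: "\<Gamma> \<longlonglongrightarrow> \<Gamma>'"
    unfolding \<Gamma>_def[abs_def] \<Gamma>'_def
  proof (rule phi32_reg_tendsto[OF q(2) q0 ok])
    have "(\<lambda>n. u * q ^ n / q) \<longlonglongrightarrow> 0" for u
      using tendsto_geometric_zero[OF q(2), of "u / q"] by simp
    then show "(\<lambda>n. B * q ^ n / q) \<longlonglongrightarrow> 0" "(\<lambda>n. C * q ^ n / q) \<longlonglongrightarrow> 0" by blast+
    show "(\<lambda>n. B*C*lam_m * (D * q ^ n / q)) \<longlonglongrightarrow> 0" "(\<lambda>n. B*C*lam_m * (A * q ^ n / q)) \<longlonglongrightarrow> 0"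
      unfolding de_eq by (rule tendsto_geometric_zero[OF q(2)])+
  qed
  have \<Gamma>'_nz: "\<Gamma>' \<noteq> 0"
    unfolding \<Gamma>'_def
  proof (rule phi32_reg_limit_nonzero[OF q(2) q0])
    have "B*C*lam_m * w = q * (lam_m / lam_p)"
      using lam0 P by (simp add: w_def lam_p_eq P_def)
    then have "norm (B*C*lam_m * w) = norm q * norm (lam_m / lam_p)"
      by (simp only: norm_mult)
    also have "\<dots> \<le> 1 * norm (lam_m / lam_p)" using q by (intro mult_right_mono) auto
    finally show "norm (B*C*lam_m * w) < 1" using branch by simp
  qed

  let ?num = "phi32 q (B*C*lam_m) B C (B*C*D*lam_m) (A*B*C*lam_m) (A*D*lam_m)"
  let ?den = "phi32 q (B*C*lam_m) (B/q) (C/q) (B*C*D*lam_m/q) (A*B*C*lam_m/q) (A*D*lam_m)"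
  have \<Gamma>0: "\<Gamma> 0 = qpoch_inf q w * ?den"
  proof -
    have "\<not> is_pole (phi32 q (B*C*lam_m) (B/q) (C/q) (B*C*D*lam_m/q) (A*B*C*lam_m/q)) w"
      using den_defined by (simp add: phi32_defined_def w_def)
    from phi32_reg_eq_mult_phi32[OF q(2) q0 _ this] ok[of 0]
    show ?thesis by (simp add: \<Gamma>_def w_def mult_ac)
  qed
  have \<Gamma>1: "\<Gamma> 1 = qpoch_inf q w * ?num"
  proof -
    have "\<not> is_pole (phi32 q (B*C*lam_m) B C (B*C*D*lam_m) (A*B*C*lam_m)) w"
      using num_defined by (simp add: phi32_defined_def w_def)
    from phi32_reg_eq_mult_phi32[OF q(2) q0 _ this] ok[of 1] q0
    show ?thesis by (simp add: \<Gamma>_def w_def mult_ac)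
  qed
  have E: "qpoch_inf q w \<noteq> 0"
  proof
    assume "qpoch_inf q w = 0"
    then have "\<Gamma> n = 0 \<and> \<Gamma> (Suc n) = 0" for n
    proof (induction n)
      case 0
      then show ?case using \<Gamma>0 \<Gamma>1 by simp
    next
      case (Suc n)
      \<comment> \<open>\<open>b_nonzero\<close> enters through \<open>upper\<close>: it keeps the
        coefficient of \<open>\<Gamma> (Suc (Suc n))\<close> away from 0.\<close>
      then show ?case using rec[of n] lam0 upper[of n] de_nz[of n] by simp
    qed
    then have "\<Gamma> = (\<lambda>_. 0)" by blast
    with \<Gamma>_lim have "\<Gamma>' = 0" by (simp add: LIMSEQ_const_iff)
    with \<Gamma>'_nz show False ..
  qed

  \<comment> \<open>The rescaling by \<open>lam_m ^ n * \<nu> n\<close> makes the leading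
    coefficient of \<open>rec\<close> equal to 1. \<open>X\<close> starts at
    \<open>\<Gamma> 1\<close>, so the term with \<open>\<Gamma> 0\<close> in the first recurrence
    step becomes \<open>W\<close>, and \<open>X 0 / W\<close> contains numerator over
    denominator.\<close>
  define \<nu> where "\<nu> n = qpoch q A n * qpoch q B n * qpoch q C n * qpoch q D n / (qpoch q d n * qpoch q e n)" for n
  define X where "X n = lam_m ^ n * \<nu> n * \<Gamma> (Suc n)" for n
  define W where "W = lam_p * ((1 - d/q) * (1 - e/q)) * \<Gamma> 0"
  have \<nu>0: "\<nu> 0 = 1" by (simp add: \<nu>_def qpoch_def)
  have \<nu>_Suc: "\<nu> (Suc n) = \<nu> n * (((1 - A*q^n) * (1 - B*q^n) * (1 - C*q^n) * (1 - D*q^n)) / ((1 - d*q^n) * (1 - e*q^n)))" for n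
    by (simp add: \<nu>_def qpoch_Suc mult_ac)
  have X_Suc: "X (Suc n) = (z - a n) * X n - lam_m ^ n * \<nu> n * (lam_p * ((1 - d/q*q^n) * (1 - e/q*q^n)) * \<Gamma> n)" for n
  proof -
    have "X (Suc n) = lam_m ^ n * \<nu> n * (lam_m * ((1 - A*q^n) * (1 - B*q^n) * (1 - C*q^n) * (1 - D*q^n)) / ((1 - d*q^n) * (1 - e*q^n)) * \<Gamma> (Suc (Suc n)))"
      by (simp add: X_def \<nu>_Suc mult_ac)
    then show ?thesis unfolding rec by (simp add: X_def algebra_simps)
  qed
  have b2: "(b (Suc n))\<^sup>2 = q / P * ((1 - A*q^n) * (1 - B*q^n) * (1 - C*q^n) * (1 - D*q^n))" for n
    using b[of "Suc n"] by (simp add: P_def mult_ac)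
  have lim_nz: "qpoch_inf q A \<noteq> 0" "qpoch_inf q B \<noteq> 0" "qpoch_inf q C \<noteq> 0" "qpoch_inf q D \<noteq> 0"
    "qpoch_inf q d \<noteq> 0" "qpoch_inf q e \<noteq> 0"
    using upper de_nz by (auto intro!: qpoch_inf_nonzero[OF q(2)])
  note poch_lim = qpoch_tendsto[OF q(2)]
  \<comment> \<open>The products of the b_k^2 grow like (q/P)^n = (lam_p*lam_m)^n. With \<mu> =
    lam_m this rate is r*\<mu>^2 exactly for r = lam_p/lam_m.\<close>
  have "cf_has_value (\<lambda>n. if n = 0 then 1 else - (b n)\<^sup>2) (\<lambda>n. z - a n) (X 0 / W)"
  proof (rule cf_has_value_of_minimal_solution[where \<mu> = lam_m and r = "lam_p / lam_m"])
    show "X (Suc 0) = (z - a 0) * X 0 - W" by (simp add: X_Suc \<nu>0 W_def)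
    show "X (Suc (Suc n)) = (z - a (Suc n)) * X (Suc n) + (if Suc n = 0 then 1 else - (b (Suc n))\<^sup>2) * X n" for n
    proof -
      \<comment> \<open>\<open>1 - d/q*q^Suc n\<close> is \<open>1 - d*q^n\<close>, and likewise for
        e, so the denominators of the new factor in \<open>\<nu> (Suc n)\<close> cancel; lam_p*lam_m
        = q/P then completes b_(n+1)^2.\<close>
      have "lam_m ^ Suc n * \<nu> (Suc n) * (lam_p * ((1 - d/q*q^Suc n) * (1 - e/q*q^Suc n)) * \<Gamma> (Suc n))
        = (lam_p * lam_m) * (((1 - A*q^n) * (1 - B*q^n) * (1 - C*q^n) * (1 - D*q^n)) * X n)"
        using de_nz[of n] q0 by (simp add: \<nu>_Suc X_def)
      then show ?thesis unfolding X_Suc[of "Suc n"] prod b2 by (simp add: mult_ac)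
    qed
    show "W \<noteq> 0"
      using lam0 den_nonzero E by (simp add: W_def \<Gamma>0 d_def e_def)
    have "(\<lambda>n. \<nu> n * \<Gamma> (Suc n)) \<longlonglongrightarrow>
        qpoch_inf q A * qpoch_inf q B * qpoch_inf q C * qpoch_inf q D / (qpoch_inf q d * qpoch_inf q e) * \<Gamma>'"
      unfolding \<nu>_def by (intro tendsto_intros poch_lim LIMSEQ_Suc[OF \<Gamma>_lim]) (use lim_nz in auto)
    then show "(\<lambda>n. X n / lam_m ^ n) \<longlonglongrightarrow>
        qpoch_inf q A * qpoch_inf q B * qpoch_inf q C * qpoch_inf q D / (qpoch_inf q d * qpoch_inf q e) * \<Gamma>'"
      using lam0 by (simp add: X_def)
    show "qpoch_inf q A * qpoch_inf q B * qpoch_inf q C * qpoch_inf q D / (qpoch_inf q d * qpoch_inf q e) * \<Gamma>' \<noteq> 0"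
      using lim_nz \<Gamma>'_nz by simp
    have "(\<lambda>n. qpoch q A n * qpoch q B n * qpoch q C n * qpoch q D n) \<longlonglongrightarrow>
        qpoch_inf q A * qpoch_inf q B * qpoch_inf q C * qpoch_inf q D"
      by (intro tendsto_intros poch_lim)
    moreover have "(\<Prod>k<n. - (if Suc k = 0 then 1 else - (b (Suc k))\<^sup>2)) / (lam_p / lam_m * lam_m\<^sup>2) ^ n
        = qpoch q A n * qpoch q B n * qpoch q C n * qpoch q D n" for n
    proof -
      define h where "h = q / P"
      have h: "lam_p / lam_m * lam_m\<^sup>2 = h" "h \<noteq> 0"
        using lam0 prod q0 P by (simp_all add: h_def power2_eq_square)
      have "(\<Prod>k<n. - (if Suc k = 0 then 1 else - (b (Suc k))\<^sup>2))
          = h ^ n * (qpoch q A n * qpoch q B n * qpoch q C n * qpoch q D n)"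
        by (simp add: b2 h_def[symmetric] prod.distrib qpoch_def)
      then show ?thesis unfolding h(1) using h(2) by simp
    qed
    ultimately show "(\<lambda>n. (\<Prod>k<n. - (if Suc k = 0 then 1 else - (b (Suc k))\<^sup>2)) / (lam_p / lam_m * lam_m\<^sup>2) ^ n)
        \<longlonglongrightarrow> qpoch_inf q A * qpoch_inf q B * qpoch_inf q C * qpoch_inf q D"
      by simp
    show "qpoch_inf q A * qpoch_inf q B * qpoch_inf q C * qpoch_inf q D \<noteq> 0" using lim_nz by simp
    show "1 < norm (lam_p / lam_m)" using branch lam0 by (simp add: norm_divide field_simps)
  qed (use lam0 in simp_all)
  moreover have "X 0 / W = A*B*C*D*lam_m / (q * (1 - B*C*D*lam_m/q) * (1 - A*B*C*lam_m/q)) * (?num / ?den)"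
  proof -
    have "X 0 / W = qpoch_inf q w * ?num / (lam_p * ((1 - d/q) * (1 - e/q)) * (qpoch_inf q w * ?den))"
      using \<Gamma>1 by (simp add: X_def \<nu>0 W_def \<Gamma>0)
    also have "\<dots> = 1 / lam_p * (1 / ((1 - d/q) * (1 - e/q))) * (?num / ?den)"
      using E by simp
    also have "1 / lam_p = P * lam_m / q" by (simp add: lam_p_eq)
    finally show ?thesis by (simp add: P_def d_def e_def mult_ac)
  qed
  ultimately show ?thesis by simp
qed

end
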